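(* Any PNMC pseudo-umbilical biharmonic submanifold in $\mathbb{S}^n$ is minimal in a small hypersphere $\mathbb{S}^{n-1}(1/\sqrt 2)\subset\mathbb{S}^n$.
   Context: All manifolds are smooth and connected. $\mathbb{S}^n\subset\mathbb{R}^{n+1}$ is the unit Euclidean sphere. Let $\varphi:M^m\to N$ be the inclusion of an $m$-dimensional submanifold in a Riemannian manifold $N$, with mean curvature vector field $H$ (so $mH$ is the trace of the second fundamental form) and mean curvature $f=|H|$. $M$ is biharmonic if $\Delta H+\operatorname{trace}R^N(d\varphi(\cdot),H)d\varphi(\cdot)=0$, where $\Delta V=-\operatorname{trace}\nabla^2V$ is the rough Laplacian on sections of $\varphi^{-1}(TN)$ and $R^N(X,Y)=[\nabla_X,\nabla_Y]-\nabla_{[X,Y]}$. $M$ is PNMC if $f>0$ everywhere and $\nabla^\perp(H/f)=0$, where $\nabla^\perp$ is the normal connection. $M$ is pseudo-umbilical if the Weingarten operator in the direction of $H$ satisfies $A_H=f^2\operatorname{Id}$. $\mathbb{S}^{n-1}(1/\sqrt2)=\{(x,1/\sqrt2)\in\mathbb{R}^{n+1}:x\in\mathbb{R}^n,|x|^2=1/2\}\subset\mathbb{S}^n$, understood up to isometries of $\mathbb{S}^n$. *)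

theory Defs
  imports "HOL-Analysis.Analysis"
begin

section \<open>Smooth maps on open sets\<close>

primrec Ck_on :: "nat \<Rightarrow> 'a::real_normed_vector set \<Rightarrow> ('a \<Rightarrow> 'b::real_normed_vector) \<Rightarrow> bool" where
  "Ck_on 0 U f \<longleftrightarrow> continuous_on U f"
| "Ck_on (Suc k) U f \<longleftrightarrow>
     (\<forall>u\<in>U. f differentiable (at u)) \<and>
     (\<forall>v. Ck_on k U (\<lambda>u. frechet_derivative f (at u) v))"

definition smooth_on :: "'a::real_normed_vector set \<Rightarrow> ('a \<Rightarrow> 'b::real_normed_vector) \<Rightarrow> bool" where
  "smooth_on U f \<longleftrightarrow> (\<forall>k. Ck_on k U f)"


section \<open>The Riemannian geometry of a submanifold of a Euclidean space\<close>

text \<open>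
  The ambient Riemannian manifold \<open>N\<close> is an embedded submanifold of a Euclidean space with the
  induced metric (below: a sphere or a small hypersphere). Vector fields on \<open>N\<close> are functions into
  the Euclidean space whose values off \<open>N\<close> are irrelevant.
\<close>

definition tangent_space :: "'e::euclidean_space set \<Rightarrow> 'e \<Rightarrow> 'e set" where
  "tangent_space N p =
     {v. \<exists>\<gamma>::real \<Rightarrow> 'e. range \<gamma> \<subseteq> N \<and> \<gamma> 0 = p \<and> (\<gamma> has_vector_derivative v) (at 0)}"

definition orth_proj :: "'e::euclidean_space set \<Rightarrow> 'e \<Rightarrow> 'e" where
  "orth_proj T v = (THE w. w \<in> T \<and> (\<forall>t\<in>T. (v - w) \<bullet> t = 0))"

text \<open>
  Euclidean derivative, in a direction \<open>v\<close> tangent to \<open>N\<close>, of a function that is given only on \<open>N\<close>.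
\<close>
definition dir_deriv :: "'e::euclidean_space set \<Rightarrow> ('e \<Rightarrow> 'e) \<Rightarrow> 'e \<Rightarrow> 'e \<Rightarrow> 'e" where
  "dir_deriv N Z p v =
     (THE w. \<forall>\<gamma>::real \<Rightarrow> 'e. range \<gamma> \<subseteq> N \<and> \<gamma> 0 = p \<and> (\<gamma> has_vector_derivative v) (at 0)
               \<longrightarrow> ((\<lambda>t. Z (\<gamma> t)) has_vector_derivative w) (at 0))"

text \<open>
  The Levi-Civita connection of the induced metric is the tangential part of the Euclidean
  derivative.
\<close>
definition nabla :: "'e::euclidean_space set \<Rightarrow> ('e \<Rightarrow> 'e) \<Rightarrow> ('e \<Rightarrow> 'e) \<Rightarrow> 'e \<Rightarrow> 'e" where
  "nabla N X Z p = orth_proj (tangent_space N p) (dir_deriv N Z p (X p))"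

definition lie_bracket :: "'e::euclidean_space set \<Rightarrow> ('e \<Rightarrow> 'e) \<Rightarrow> ('e \<Rightarrow> 'e) \<Rightarrow> 'e \<Rightarrow> 'e" where
  "lie_bracket N X Y p = dir_deriv N Y p (X p) - dir_deriv N X p (Y p)"

definition curvature_fields ::
    "'e::euclidean_space set \<Rightarrow> ('e \<Rightarrow> 'e) \<Rightarrow> ('e \<Rightarrow> 'e) \<Rightarrow> ('e \<Rightarrow> 'e) \<Rightarrow> 'e \<Rightarrow> 'e" where
  "curvature_fields N X Y Z p =
     nabla N X (nabla N Y Z) p - nabla N Y (nabla N X Z) p - nabla N (lie_bracket N X Y) Z p"

text \<open>
  The curvature is tensorial, so its value on vectors tangent at \<open>p\<close> may be computed with any smooth
  tangent extensions; we extend \<open>a\<close> by its orthogonal projections onto the tangent spaces of \<open>N\<close>.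
\<close>
definition curvature :: "'e::euclidean_space set \<Rightarrow> 'e \<Rightarrow> 'e \<Rightarrow> 'e \<Rightarrow> 'e \<Rightarrow> 'e" where
  "curvature N p a b c =
     (let E = (\<lambda>a q. orth_proj (tangent_space N q) a)
      in curvature_fields N (E a) (E b) (E c) p)"


section \<open>Submanifolds\<close>

text \<open>
  A submanifold is a set \<open>M\<close> together with an atlas \<open>A\<close> of local parametrizations \<open>(U, x)\<close>, with
  \<open>U\<close> open in \<open>\<real>\<^sup>m\<close>; the inclusion of \<open>M\<close> is an immersion. The manifold topology may be finer than
  the subspace topology, so that both embedded and injectively immersed submanifolds are covered. It
  is Hausdorff because the inclusion is continuous and injective, and if it is connected then it is
  also second countable, as the induced Riemannian distance makes it a connected, locally compact,
  metrizable manifold.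
\<close>

type_synonym ('m, 'e) atlas = "((real^'m) set \<times> (real^'m \<Rightarrow> 'e)) set"

definition manifold_topology :: "'e set \<Rightarrow> ('m::finite, 'e) atlas \<Rightarrow> 'e topology" where
  "manifold_topology M A =
     topology (\<lambda>T. T \<subseteq> M \<and> (\<forall>(U, x)\<in>A. open {u \<in> U. x u \<in> T}))"

lemma openin_manifold_topology:
  "openin (manifold_topology M A) T \<longleftrightarrow> T \<subseteq> M \<and> (\<forall>(U, x)\<in>A. open {u \<in> U. x u \<in> T})"
proof -
  have "istopology (\<lambda>T. T \<subseteq> M \<and> (\<forall>(U, x)\<in>A. open {u \<in> U. x u \<in> T}))"
    unfolding istopology_def
  proof (intro conjI allI impI)
    fix S T assume S: "S \<subseteq> M \<and> (\<forall>(U, x)\<in>A. open {u \<in> U. x u \<in> S})"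
      and T: "T \<subseteq> M \<and> (\<forall>(U, x)\<in>A. open {u \<in> U. x u \<in> T})"
    show "S \<inter> T \<subseteq> M" using S by blast
    show "\<forall>(U, x)\<in>A. open {u \<in> U. x u \<in> S \<inter> T}"
    proof clarify
      fix U x assume "(U, x) \<in> A"
      then have "open ({u \<in> U. x u \<in> S} \<inter> {u \<in> U. x u \<in> T})"
        using S T by (intro open_Int) blast+
      also have "{u \<in> U. x u \<in> S} \<inter> {u \<in> U. x u \<in> T} = {u \<in> U. x u \<in> S \<inter> T}"
        by blast
      finally show "open {u \<in> U. x u \<in> S \<inter> T}" .
    qed
  next
    fix K assume K: "\<forall>T\<in>K. T \<subseteq> M \<and> (\<forall>(U, x)\<in>A. open {u \<in> U. x u \<in> T})"
    show "\<Union>K \<subseteq> M" using K by blast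
    show "\<forall>(U, x)\<in>A. open {u \<in> U. x u \<in> \<Union>K}"
    proof clarify
      fix U x assume "(U, x) \<in> A"
      then have "open (\<Union>T\<in>K. {u \<in> U. x u \<in> T})"
        using K by (intro open_UN) blast
      also have "(\<Union>T\<in>K. {u \<in> U. x u \<in> T}) = {u \<in> U. x u \<in> \<Union>K}"
        by blast
      finally show "open {u \<in> U. x u \<in> \<Union>K}" .
    qed
  qed
  then show ?thesis
    by (simp add: manifold_topology_def topology_inverse')
qed

definition submanifold :: "'e::euclidean_space set \<Rightarrow> 'e set \<Rightarrow> ('m::finite, 'e) atlas \<Rightarrow> bool" where
  "submanifold N M A \<longleftrightarrow>
     M \<subseteq> N \<and>
     M = (\<Union>(U, x)\<in>A. x ` U) \<and>
     (\<forall>(U, x)\<in>A. open U \<and> smooth_on U x \<and> inj_on x U \<and>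
                  (\<forall>u\<in>U. inj (frechet_derivative x (at u)))) \<and>
     (\<forall>(U, x)\<in>A. \<forall>(V, y)\<in>A.
        let W = {u \<in> U. x u \<in> y ` V} in open W \<and> smooth_on W (\<lambda>u. inv_into V y (x u))) \<and>
     connected_space (manifold_topology M A)"


section \<open>Geometry of a submanifold in a parametrization\<close>

text \<open>
  All the notions below are local. They are written for the immersion \<open>x\<close> into \<open>N\<close> given by a local
  parametrization: points of \<open>M\<close> are represented by coordinates \<open>u\<close>, vectors tangent to \<open>M\<close> by
  \<open>\<xi> \<in> \<real>\<^sup>m\<close> (standing for \<open>dx\<^sub>u \<xi>\<close>), and sections of the pull-back of \<open>TN\<close> by functions \<open>V\<close> of \<open>u\<close>. A
  constant \<open>\<xi>\<close> is a coordinate vector field.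
\<close>

abbreviation push :: "(real^'m \<Rightarrow> 'e::euclidean_space) \<Rightarrow> real^'m \<Rightarrow> real^'m \<Rightarrow> 'e" where
  "push x u \<equiv> frechet_derivative x (at u)"

definition tan_part :: "(real^'m \<Rightarrow> 'e::euclidean_space) \<Rightarrow> real^'m \<Rightarrow> 'e \<Rightarrow> 'e" where
  "tan_part x u w = orth_proj (range (push x u)) w"

definition metric_coeffs :: "(real^'m \<Rightarrow> 'e::euclidean_space) \<Rightarrow> real^'m \<Rightarrow> real^'m^'m" where
  "metric_coeffs x u = (\<chi> i j. push x u (axis i 1) \<bullet> push x u (axis j 1))"

text \<open>Trace of a bilinear map with respect to the induced metric, \<open>\<Sum> g\<^sup>i\<^sup>j b(\<partial>\<^sub>i, \<partial>\<^sub>j)\<close>.\<close>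
definition metric_trace ::
    "(real^'m \<Rightarrow> 'e::euclidean_space) \<Rightarrow> real^'m \<Rightarrow> (real^'m \<Rightarrow> real^'m \<Rightarrow> 'e) \<Rightarrow> 'e" where
  "metric_trace x u b =
     (\<Sum>i\<in>UNIV. \<Sum>j\<in>UNIV. (matrix_inv (metric_coeffs x u) $ i $ j) *\<^sub>R b (axis i 1) (axis j 1))"

text \<open>The connection induced by that of \<open>N\<close> on the pull-back of \<open>TN\<close>.\<close>
definition pullback_conn ::
    "'e::euclidean_space set \<Rightarrow> (real^'m \<Rightarrow> 'e) \<Rightarrow> (real^'m \<Rightarrow> 'e) \<Rightarrow> real^'m \<Rightarrow> real^'m \<Rightarrow> 'e" where
  "pullback_conn N x V u \<xi> = orth_proj (tangent_space N (x u)) (frechet_derivative V (at u) \<xi>)"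

text \<open>
  Gauss formula: the covariant derivative in \<open>N\<close> of the coordinate field \<open>\<eta>\<close> in the direction \<open>\<xi>\<close>
  splits into the Levi-Civita connection of \<open>M\<close> and the second fundamental form.
\<close>
definition levi_civita ::
    "'e::euclidean_space set \<Rightarrow> (real^'m \<Rightarrow> 'e) \<Rightarrow> real^'m \<Rightarrow> real^'m \<Rightarrow> real^'m \<Rightarrow> real^'m" where
  "levi_civita N x u \<xi> \<eta> =
     (THE \<zeta>. push x u \<zeta> = tan_part x u (pullback_conn N x (\<lambda>s. push x s \<eta>) u \<xi>))"

definition second_ff ::
    "'e::euclidean_space set \<Rightarrow> (real^'m \<Rightarrow> 'e) \<Rightarrow> real^'m \<Rightarrow> real^'m \<Rightarrow> real^'m \<Rightarrow> 'e" where
  "second_ff N x u \<xi> \<eta> =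
     (let w = pullback_conn N x (\<lambda>s. push x s \<eta>) u \<xi> in w - tan_part x u w)"

definition mean_curv_vector ::
    "'e::euclidean_space set \<Rightarrow> (real^'m \<Rightarrow> 'e) \<Rightarrow> real^'m \<Rightarrow> 'e" where
  "mean_curv_vector N x u = (1 / real CARD('m)) *\<^sub>R metric_trace x u (second_ff N x u)"

definition mean_curvature :: "'e::euclidean_space set \<Rightarrow> (real^'m \<Rightarrow> 'e) \<Rightarrow> real^'m \<Rightarrow> real" where
  "mean_curvature N x u = norm (mean_curv_vector N x u)"

definition normal_conn ::
    "'e::euclidean_space set \<Rightarrow> (real^'m \<Rightarrow> 'e) \<Rightarrow> (real^'m \<Rightarrow> 'e) \<Rightarrow> real^'m \<Rightarrow> real^'m \<Rightarrow> 'e" where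
  "normal_conn N x V u \<xi> =
     (let w = pullback_conn N x V u \<xi> in w - tan_part x u w)"

text \<open>\<open>dx (A\<^sub>V \<xi>)\<close> for a normal section \<open>V\<close>.\<close>
definition weingarten ::
    "'e::euclidean_space set \<Rightarrow> (real^'m \<Rightarrow> 'e) \<Rightarrow> (real^'m \<Rightarrow> 'e) \<Rightarrow> real^'m \<Rightarrow> real^'m \<Rightarrow> 'e" where
  "weingarten N x V u \<xi> = - tan_part x u (pullback_conn N x V u \<xi>)"

definition second_cov_deriv ::
    "'e::euclidean_space set \<Rightarrow> (real^'m \<Rightarrow> 'e) \<Rightarrow> (real^'m \<Rightarrow> 'e) \<Rightarrow> real^'m
       \<Rightarrow> real^'m \<Rightarrow> real^'m \<Rightarrow> 'e" where
  "second_cov_deriv N x V u \<xi> \<eta> =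
     pullback_conn N x (\<lambda>s. pullback_conn N x V s \<eta>) u \<xi>
     - pullback_conn N x V u (levi_civita N x u \<xi> \<eta>)"

definition rough_laplacian ::
    "'e::euclidean_space set \<Rightarrow> (real^'m \<Rightarrow> 'e) \<Rightarrow> (real^'m \<Rightarrow> 'e) \<Rightarrow> real^'m \<Rightarrow> 'e" where
  "rough_laplacian N x V u = - metric_trace x u (second_cov_deriv N x V u)"


section \<open>Classes of submanifolds\<close>

definition biharmonic :: "'e::euclidean_space set \<Rightarrow> ('m::finite, 'e) atlas \<Rightarrow> bool" where
  "biharmonic N A \<longleftrightarrow>
     (\<forall>(U, x)\<in>A. \<forall>u\<in>U.
        rough_laplacian N x (mean_curv_vector N x) u
        + metric_trace x u
            (\<lambda>\<xi> \<eta>. curvature N (x u) (push x u \<xi>) (mean_curv_vector N x u) (push x u \<eta>)) = 0)"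

definition pnmc :: "'e::euclidean_space set \<Rightarrow> ('m::finite, 'e) atlas \<Rightarrow> bool" where
  "pnmc N A \<longleftrightarrow>
     (\<forall>(U, x)\<in>A. \<forall>u\<in>U.
        mean_curvature N x u > 0 \<and>
        (\<forall>\<xi>. normal_conn N x (\<lambda>s. (1 / mean_curvature N x s) *\<^sub>R mean_curv_vector N x s) u \<xi> = 0))"

definition pseudo_umbilical :: "'e::euclidean_space set \<Rightarrow> ('m::finite, 'e) atlas \<Rightarrow> bool" where
  "pseudo_umbilical N A \<longleftrightarrow>
     (\<forall>(U, x)\<in>A. \<forall>u\<in>U. \<forall>\<xi>.
        weingarten N x (mean_curv_vector N x) u \<xi> = (mean_curvature N x u)\<^sup>2 *\<^sub>R push x u \<xi>)"

definition minimal :: "'e::euclidean_space set \<Rightarrow> ('m::finite, 'e) atlas \<Rightarrow> bool" where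
  "minimal N A \<longleftrightarrow> (\<forall>(U, x)\<in>A. \<forall>u\<in>U. mean_curv_vector N x u = 0)"


section \<open>Spheres\<close>

text \<open>\<open>\<real>\<^sup>n\<^sup>+\<^sup>1\<close> is \<open>\<real>\<^sup>n \<times> \<real>\<close> with the (Euclidean) product inner product.\<close>

definition unit_sphere :: "((real^'n) \<times> real) set" where
  "unit_sphere = sphere 0 1"

definition small_hypersphere :: "((real^'n) \<times> real) set" where
  "small_hypersphere = {(y, 1 / sqrt 2) | y. (norm y)\<^sup>2 = 1 / 2}"

end

theory Submission
  imports Defs
begin

text \<open>
  Write \<open>h\<close> for the mean curvature vector, \<open>F = \<bar>h\<bar>\<^sup>2\<close> and \<open>\<alpha> = d(log \<bar>h\<bar>)\<close>. The PNMC and pseudo-umbilical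
  conditions give \<open>dh(\<xi>) = \<alpha>(\<xi>) h - F dx(\<xi>)\<close>. Differentiating once more and taking the trace turns the
  biharmonic equation \<open>trace \<nabla>\<^sup>2h = -m h\<close> into \<open>\<lambda> h - 3 F grad(log \<bar>h\<bar>) - m F h = -m h\<close>, where \<open>\<lambda>\<close>
  is built from \<open>\<alpha>\<close> and its first derivatives: the tangential part yields \<open>\<alpha> = 0\<close>, then
  \<open>\<lambda> = 0\<close> and \<open>F = 1\<close>. Hence \<open>d(x + h) = 0\<close>, so \<open>c = x + h\<close> is locally constant
  with \<open>\<bar>c\<bar>\<^sup>2 = 2\<close> and \<open>x \<bullet> c = 1\<close>: locally, \<open>M\<close> lies in a small hypersphere of radius \<open>1/\<surd>2\<close>, whose
  unit normal in the sphere is \<open>h\<close>, and therefore \<open>M\<close> is minimal there. That \<open>c\<close> does not depend on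
  the parametrization follows from the trace of the second derivative of \<open>x \<bullet> c = 1\<close>, and
  connectedness makes \<open>c\<close> global.
\<close>

section \<open>Closure properties of smooth maps\<close>

lemma Ck_on_cong:
  assumes "open U" "\<And>u. u \<in> U \<Longrightarrow> f u = g u"
  shows "Ck_on k U f \<longleftrightarrow> Ck_on k U g"
  using assms(2)
proof (induction k arbitrary: f g)
  case 0
  then show ?case by (simp cong: continuous_on_cong)
next
  case (Suc k)
  have diff: "f differentiable (at u) \<longleftrightarrow> g differentiable (at u)" if "u \<in> U" for u
    unfolding differentiable_def
    by (intro iff_exI iffI; erule has_derivative_transform_within_open[OF _ assms(1) that])
      (use Suc.prems in auto)
  have "Ck_on k U (\<lambda>u. frechet_derivative f (at u) v) \<longleftrightarrow> Ck_on k U (\<lambda>u. frechet_derivative g (at u) v)"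
    if "\<forall>u\<in>U. f differentiable (at u)" for v
  proof (rule Suc.IH)
    fix u assume "u \<in> U"
    then have "frechet_derivative f (at u) = frechet_derivative g (at u)"
      using frechet_derivative_transform_within_open[OF _ assms(1), of f u g] Suc.prems that by blast
    then show "frechet_derivative f (at u) v = frechet_derivative g (at u) v" by simp
  qed
  with diff show ?case by auto
qed

lemma Ck_on_Suc_imp: "Ck_on (Suc k) U f \<Longrightarrow> Ck_on k U f"
proof (induction k arbitrary: f)
  case 0
  then show ?case
    by (simp add: continuous_at_imp_continuous_on differentiable_imp_continuous_within)
next
  case (Suc k)
  show ?case unfolding Ck_on.simps(2)[of k]
  proof (intro conjI allI)
    show "\<forall>u\<in>U. f differentiable at u" using Suc.prems by simp
    show "Ck_on k U (\<lambda>u. frechet_derivative f (at u) v)" for v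
      using Suc.IH Suc.prems unfolding Ck_on.simps(2)[of "Suc k"] by blast
  qed
qed

text \<open>Lets inductions on \<open>k\<close> work with an explicit derivative formula; openness
  of \<open>U\<close> carries the regularity over to \<open>frechet_derivative\<close>.\<close>

lemma Ck_on_SucI:
  assumes "open U" "\<And>u. u \<in> U \<Longrightarrow> (f has_derivative f' u) (at u)"
    and "\<And>v. Ck_on k U (\<lambda>u. f' u v)"
  shows "Ck_on (Suc k) U f"
proof -
  have "frechet_derivative f (at u) = f' u" if "u \<in> U" for u
    using frechet_derivative_at[OF assms(2)[OF that]] by simp
  then have "Ck_on k U (\<lambda>u. frechet_derivative f (at u) v)" for v
    using assms(3) Ck_on_cong[OF assms(1), of "\<lambda>u. frechet_derivative f (at u) v" "\<lambda>u. f' u v"] by simp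
  with assms(2) show ?thesis by (auto simp: differentiable_def)
qed

lemma Ck_on_has_derivative:
  "Ck_on (Suc k) U f \<Longrightarrow> u \<in> U \<Longrightarrow> (f has_derivative frechet_derivative f (at u)) (at u)"
  by (simp add: frechet_derivative_works)

lemma frechet_derivative_apply:
  "(f has_derivative f') (at u) \<Longrightarrow> frechet_derivative f (at u) v = f' v"
  by (simp flip: frechet_derivative_at)

lemma Ck_on_const: "Ck_on k U (\<lambda>u. c)"
  by (induction k arbitrary: c) auto

lemma Ck_on_add:
  assumes "open U" "Ck_on k U f" "Ck_on k U g"
  shows "Ck_on k U (\<lambda>u. f u + g u)"
  using assms(2,3)
proof (induction k arbitrary: f g)
  case 0
  then show ?case by (simp add: continuous_on_add)
next
  case (Suc k)
  show ?case
  proof (rule Ck_on_SucI[OF assms(1) has_derivative_add[of f "frechet_derivative f (at u)" _ g "frechet_derivative g (at u)" for u]])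
    fix v
    show "Ck_on k U (\<lambda>u. frechet_derivative f (at u) v + frechet_derivative g (at u) v)"
      using Suc by simp
  qed (use Suc.prems in \<open>auto simp: frechet_derivative_works[symmetric]\<close>)
qed

text \<open>By the Leibniz rule the derivative is a sum of two products with one differentiated
  factor each, to which the induction hypothesis applies. Inner product, multiplication and scaling
  are instances.\<close>

lemma (in bounded_bilinear) Ck_on:
  assumes "open U" "Ck_on k U f" "Ck_on k U g"
  shows "Ck_on k U (\<lambda>u. prod (f u) (g u))"
  using assms(2,3)
proof (induction k arbitrary: f g)
  case 0
  then show ?case by (simp add: continuous_on)
next
  case (Suc k)
  show ?case
  proof (rule Ck_on_SucI[OF assms(1) FDERIV[of f "frechet_derivative f (at u)" _ _ g "frechet_derivative g (at u)" for u]])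
    fix v
    show "Ck_on k U (\<lambda>u. prod (f u) (frechet_derivative g (at u) v) + prod (frechet_derivative f (at u) v) (g u))"
      using Suc.prems Suc.prems[THEN Ck_on_Suc_imp]
      by (intro Ck_on_add[OF assms(1) Suc.IH Suc.IH]) auto
  qed (use Suc.prems in \<open>auto simp: frechet_derivative_works[symmetric]\<close>)
qed

text \<open>The derivative \<open>- (1/f) f' (1/f)\<close> involves only \<open>f'\<close> and
  \<open>1/f\<close>, and the latter is C^k by the induction hypothesis.\<close>

lemma Ck_on_inverse:
  fixes f :: "'a::real_normed_vector \<Rightarrow> real"
  assumes "open U" "Ck_on k U f" "\<And>u. u \<in> U \<Longrightarrow> f u \<noteq> 0"
  shows "Ck_on k U (\<lambda>u. inverse (f u))"
  using assms(2)
proof (induction k)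
  case 0
  then show ?case using assms(3) by (simp add: continuous_on_inverse)
next
  case (Suc k)
  show ?case
  proof (rule Ck_on_SucI[OF assms(1) Deriv.has_derivative_inverse[where f = f and f' = "frechet_derivative f (at u)" for u]])
    fix v
    have inv: "Ck_on k U (\<lambda>u. inverse (f u))" using Suc Ck_on_Suc_imp by blast
    have "Ck_on k U (\<lambda>u. (- 1) * (inverse (f u) * frechet_derivative f (at u) v * inverse (f u)))"
      using Suc.prems inv by (intro bounded_bilinear.Ck_on[OF bounded_bilinear_mult assms(1)] Ck_on_const) auto
    then show "Ck_on k U (\<lambda>u. - (inverse (f u) * frechet_derivative f (at u) v * inverse (f u)))" by simp
  qed (use Suc.prems assms(3) in \<open>auto simp: frechet_derivative_works[symmetric]\<close>)
qed

lemma smooth_on_cong: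
  assumes "open U" "\<And>u. u \<in> U \<Longrightarrow> f u = g u"
  shows "smooth_on U f \<longleftrightarrow> smooth_on U g"
  unfolding smooth_on_def using Ck_on_cong[OF assms(1), of f g] assms(2) by simp

lemma smooth_on_has_derivative:
  "smooth_on U f \<Longrightarrow> u \<in> U \<Longrightarrow> (f has_derivative frechet_derivative f (at u)) (at u)"
  unfolding smooth_on_def using Ck_on_has_derivative by blast

lemma smooth_on_frechet_derivative:
  "smooth_on U f \<Longrightarrow> smooth_on U (\<lambda>u. frechet_derivative f (at u) v)"
  unfolding smooth_on_def using Ck_on.simps(2) by blast

lemma smooth_on_const: "smooth_on U (\<lambda>u. c)"
  by (simp add: smooth_on_def Ck_on_const)

lemma smooth_on_add:
  "open U \<Longrightarrow> smooth_on U f \<Longrightarrow> smooth_on U g \<Longrightarrow> smooth_on U (\<lambda>u. f u + g u)"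
  by (simp add: smooth_on_def Ck_on_add)

lemma (in bounded_bilinear) smooth_on:
  "open U \<Longrightarrow> smooth_on U f \<Longrightarrow> smooth_on U g \<Longrightarrow> smooth_on U (\<lambda>u. prod (f u) (g u))"
  by (simp add: smooth_on_def Ck_on)

lemmas smooth_on_inner = bounded_bilinear.smooth_on[OF bounded_bilinear_inner]
  and smooth_on_mult = bounded_bilinear.smooth_on[OF bounded_bilinear_mult]
  and smooth_on_scaleR = bounded_bilinear.smooth_on[OF bounded_bilinear_scaleR]

lemma smooth_on_inverse:
  fixes f :: "'a::real_normed_vector \<Rightarrow> real"
  shows "open U \<Longrightarrow> smooth_on U f \<Longrightarrow> (\<And>u. u \<in> U \<Longrightarrow> f u \<noteq> 0) \<Longrightarrow> smooth_on U (\<lambda>u. inverse (f u))"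
  by (simp add: smooth_on_def Ck_on_inverse)

lemma smooth_on_diff:
  assumes "open U" "smooth_on U f" "smooth_on U g"
  shows "smooth_on U (\<lambda>u. f u - g u)"
  using smooth_on_add[OF assms(1,2) smooth_on_scaleR[OF assms(1) smooth_on_const[of U "-1"] assms(3)]]
  by simp

lemma smooth_on_sum:
  assumes "open U" "\<And>i. i \<in> I \<Longrightarrow> smooth_on U (f i)"
  shows "smooth_on U (\<lambda>u. \<Sum>i\<in>I. f i u)"
  using assms(2)
  by (induction I rule: infinite_finite_induct) (auto intro: smooth_on_const smooth_on_add[OF assms(1)])

lemma smooth_on_prod:
  fixes f :: "'i \<Rightarrow> 'a::real_normed_vector \<Rightarrow> real"
  assumes "open U" "\<And>i. i \<in> I \<Longrightarrow> smooth_on U (f i)"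
  shows "smooth_on U (\<lambda>u. \<Prod>i\<in>I. f i u)"
  using assms(2)
  by (induction I rule: infinite_finite_induct) (auto intro: smooth_on_const smooth_on_mult[OF assms(1)])

section \<open>Smoothness of the inverse of a matrix-valued map\<close>

lemma smooth_on_det:
  fixes G :: "'a::real_normed_vector \<Rightarrow> real^'m^'m"
  assumes "open U" "\<And>i j. smooth_on U (\<lambda>u. G u $ i $ j)"
  shows "smooth_on U (\<lambda>u. det (G u))"
  unfolding det_def
  by (intro smooth_on_sum smooth_on_mult smooth_on_prod smooth_on_const assms)

text \<open>Column \<open>l\<close> of the inverse solves \<open>G *v v = axis l 1\<close>. Cramer's
  rule writes it as polynomials in the entries over \<open>det G\<close>, so it inherits smoothness
  from the entries.\<close>

lemma matrix_inv_eq_cramer: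
  fixes G :: "real^'m^'m"
  assumes "invertible G"
  shows "matrix_inv G $ k $ l =
    det (\<chi> i j. if j = k then axis l 1 $ i else G $ i $ j) * inverse (det G)"
proof -
  have "G ** matrix_inv G = mat 1"
    using someI_ex[OF assms[unfolded invertible_def]] by (simp add: matrix_inv_def)
  then have "G *v (matrix_inv G *v axis l 1) = axis l 1"
    by (simp add: matrix_vector_mul_assoc)
  then have "matrix_inv G *v axis l 1 = (\<chi> k. det (\<chi> i j. if j = k then axis l 1 $ i else G $ i $ j) / det G)"
    using assms cramer invertible_det_nz by blast
  moreover have "(matrix_inv G *v axis l 1) $ k = matrix_inv G $ k $ l"
    by (simp add: matrix_vector_mult_basis column_def)
  ultimately show ?thesis by (simp add: divide_inverse)
qed

lemma smooth_on_matrix_inv: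
  fixes G :: "'a::real_normed_vector \<Rightarrow> real^'m^'m"
  assumes "open U" "\<And>i j. smooth_on U (\<lambda>u. G u $ i $ j)" "\<And>u. u \<in> U \<Longrightarrow> invertible (G u)"
  shows "smooth_on U (\<lambda>u. matrix_inv (G u) $ k $ l)"
proof -
  have "smooth_on U (\<lambda>u. (\<chi> i j. if j = k then axis l 1 $ i else G u $ i $ j) $ i $ j)" for i j
    using assms(2) by (cases "j = k") (auto intro: smooth_on_const)
  then have "smooth_on U (\<lambda>u. det (\<chi> i j. if j = k then axis l 1 $ i else G u $ i $ j) * inverse (det (G u)))"
    using assms by (intro smooth_on_mult smooth_on_inverse smooth_on_det) (auto simp: invertible_det_nz)
  then show ?thesis
    by (rule smooth_on_cong[OF assms(1), THEN iffD2, rotated]) (rule matrix_inv_eq_cramer[OF assms(3)])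
qed

section \<open>Spheres and their curvature\<close>

lemma orth_proj_eqI:
  assumes "subspace T" "w \<in> T" "\<And>t. t \<in> T \<Longrightarrow> (v - w) \<bullet> t = 0"
  shows "orth_proj T v = w"
  unfolding orth_proj_def
proof (rule the_equality)
  show "w \<in> T \<and> (\<forall>t\<in>T. (v - w) \<bullet> t = 0)" using assms by blast
  fix w' assume w': "w' \<in> T \<and> (\<forall>t\<in>T. (v - w') \<bullet> t = 0)"
  \<comment> \<open>The difference lies in \<open>T\<close> and is orthogonal to \<open>T\<close>,
    hence to itself.\<close>
  then have "w' - w \<in> T" using assms subspace_diff by blast
  then have "(v - w) \<bullet> (w' - w) = 0" "(v - w') \<bullet> (w' - w) = 0"
    using w' assms(3) by blast+
  then have "(w' - w) \<bullet> (w' - w) = 0" by (simp add: inner_diff_left inner_diff_right)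
  then show "w' = w" by simp
qed

lemma
  assumes "subspace T"
  shows orth_proj_mem: "orth_proj T v \<in> T"
    and orth_proj_orthogonal: "t \<in> T \<Longrightarrow> (v - orth_proj T v) \<bullet> t = 0"
proof -
  have [simp]: "span T = T" using assms by simp
  obtain y z where "y \<in> T" "\<And>w. w \<in> T \<Longrightarrow> orthogonal z w" "v = y + z"
    using orthogonal_subspace_decomp_exists[of T v] by auto
  moreover then have "orth_proj T v = y"
    by (intro orth_proj_eqI assms) (auto simp: orthogonal_def)
  ultimately show "orth_proj T v \<in> T" "t \<in> T \<Longrightarrow> (v - orth_proj T v) \<bullet> t = 0"
    by (auto simp: orthogonal_def)
qed

lemma orth_proj_inner:
  "subspace T \<Longrightarrow> t \<in> T \<Longrightarrow> orth_proj T v \<bullet> t = v \<bullet> t"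
  using orth_proj_orthogonal[of T t v] by (simp add: inner_diff_left)

lemma linear_orth_proj:
  assumes "subspace T"
  shows "linear (orth_proj T)"
proof
  show "orth_proj T (v + w) = orth_proj T v + orth_proj T w" for v w
    by (rule orth_proj_eqI[OF assms])
      (auto simp: assms orth_proj_mem orth_proj_inner subspace_add inner_diff_left inner_add_left)
  show "orth_proj T (c *\<^sub>R v) = c *\<^sub>R orth_proj T v" for c v
    by (rule orth_proj_eqI[OF assms])
      (auto simp: assms orth_proj_mem orth_proj_inner subspace_scale inner_diff_left)
qed

lemma orth_proj_zero:
  "subspace T \<Longrightarrow> (\<And>t. t \<in> T \<Longrightarrow> v \<bullet> t = 0) \<Longrightarrow> orth_proj T v = 0"
  by (rule orth_proj_eqI) (auto simp: subspace_0)

section \<open>Tangent spaces of the unit sphere and of its hyperplane slices\<close>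

lemma tangent_space_orthogonal:
  assumes "v \<in> tangent_space N p" "\<And>q. q \<in> N \<Longrightarrow> q \<bullet> c = k"
  shows "v \<bullet> c = 0"
proof -
  obtain \<gamma> where \<gamma>: "range \<gamma> \<subseteq> N" "(\<gamma> has_vector_derivative v) (at 0)"
    using assms(1) by (auto simp: tangent_space_def)
  have "((\<lambda>t. \<gamma> t \<bullet> c) has_vector_derivative v \<bullet> c) (at (0::real))"
    by (rule bounded_linear.has_vector_derivative[OF bounded_linear_inner_left \<gamma>(2)])
  moreover have "(\<lambda>t. \<gamma> t \<bullet> c) = (\<lambda>t. k)" using \<gamma>(1) assms(2) by auto
  ultimately show ?thesis
    by (metis has_vector_derivative_const vector_derivative_at)
qed

lemma tangent_space_sphere_orthogonal:
  assumes "v \<in> tangent_space N p" "N \<subseteq> sphere 0 r"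
  shows "v \<bullet> p = 0"
proof -
  obtain \<gamma> where \<gamma>: "range \<gamma> \<subseteq> N" "\<gamma> 0 = p" "(\<gamma> has_vector_derivative v) (at 0)"
    using assms(1) by (auto simp: tangent_space_def)
  have "((\<lambda>t. \<gamma> t \<bullet> \<gamma> t) has_vector_derivative \<gamma> 0 \<bullet> v + v \<bullet> \<gamma> 0) (at (0::real))"
    by (rule bounded_bilinear.has_vector_derivative[OF bounded_bilinear_inner \<gamma>(3) \<gamma>(3)])
  moreover have "\<gamma> t \<in> sphere 0 r" for t using \<gamma>(1) assms(2) by blast
  then have "(\<lambda>t. \<gamma> t \<bullet> \<gamma> t) = (\<lambda>t. r\<^sup>2)" by (auto simp: dot_square_norm)
  ultimately have "\<gamma> 0 \<bullet> v + v \<bullet> \<gamma> 0 = 0"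
    by (metis has_vector_derivative_const vector_derivative_at)
  then show ?thesis using \<gamma>(2) by (simp add: inner_commute)
qed

text \<open>Supplies the curve for the inclusions opposite to the two lemmas above: it passes
  through \<open>b + z\<close> with velocity \<open>v\<close> on the circle about \<open>b\<close>
  of radius |z| in the plane of \<open>z\<close> and \<open>v\<close>.\<close>

lemma tangent_space_circle:
  fixes b z v :: "'e::euclidean_space"
  assumes "z \<noteq> 0" "v \<bullet> z = 0"
    and N: "\<And>w \<alpha> \<beta>. w = \<alpha> *\<^sub>R z + \<beta> *\<^sub>R v \<Longrightarrow> norm w = norm z \<Longrightarrow> b + w \<in> N"
  shows "v \<in> tangent_space N (b + z)"
proof -
  have nz: "norm z > 0" using assms by simp
  \<comment> \<open>The angular speed that gives speed |v| on a circle of radius |z|.\<close>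
  define a where "a = norm v / norm z"
  \<comment> \<open>Rescales \<open>v\<close> to the length of \<open>z\<close>. For
    \<open>v = 0\<close> the default 0 is harmless, as the curve is then constant.\<close>
  define c where "c = (if a = 0 then 0 else 1 / a)"
  have ca: "c *\<^sub>R a *\<^sub>R v = v"
    using nz by (auto simp: c_def a_def)
  define \<gamma> where "\<gamma> t = b + (cos (a * t) *\<^sub>R z + (sin (a * t) * c) *\<^sub>R v)" for t :: real
  have "\<gamma> t \<in> N" for t
    unfolding \<gamma>_def
  proof (rule N[OF refl])
    let ?w = "cos (a * t) *\<^sub>R z + (sin (a * t) * c) *\<^sub>R v"
    have cv: "c\<^sup>2 * (norm v)\<^sup>2 = (if v = 0 then 0 else (norm z)\<^sup>2)"
      using nz by (auto simp: c_def a_def power_divide)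
    have "?w \<bullet> ?w = (cos (a * t))\<^sup>2 * (norm z)\<^sup>2 + (sin (a * t))\<^sup>2 * (c\<^sup>2 * (norm v)\<^sup>2)"
      using assms(2) unfolding power2_norm_eq_inner
      by (simp add: inner_add_left inner_add_right inner_commute power2_eq_square del: dot_square_norm)
    also have "\<dots> = (norm z)\<^sup>2"
      by (cases "v = 0") (auto simp: cv a_def simp flip: distrib_right)
    finally show "norm ?w = norm z"
      by (simp add: norm_eq_sqrt_inner)
  qed
  moreover have "(\<gamma> has_vector_derivative v) (at 0)"
    unfolding \<gamma>_def using ca
    by (auto intro!: derivative_eq_intros simp: mult.commute)
  moreover have "\<gamma> 0 = b + z" by (simp add: \<gamma>_def)
  ultimately show ?thesis unfolding tangent_space_def by blast
qed

lemma tangent_space_sphere: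
  fixes p :: "'e::euclidean_space"
  assumes "p \<in> sphere 0 1"
  shows "tangent_space (sphere 0 1) p = {v. v \<bullet> p = 0}"
proof (intro equalityI subsetI CollectI)
  show "v \<bullet> p = 0" if "v \<in> tangent_space (sphere 0 1) p" for v
    using tangent_space_sphere_orthogonal[OF that] by blast
  show "v \<in> tangent_space (sphere 0 1) p" if "v \<in> {v. v \<bullet> p = 0}" for v
    using tangent_space_circle[of p v 0 "sphere 0 1"] that assms norm_zero[where 'a='e] by force
qed

text \<open>For |c|^2 = 2 the hyperplane \<open>q \<bullet> c = 1\<close> cuts the unit sphere in
  the sphere of radius 1/sqrt 2 about c/2, so \<open>tangent_space_circle\<close> is applied with
  circles centred there.\<close>

lemma tangent_space_small_sphere:
  fixes p c :: "'e::euclidean_space"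
  assumes "c \<bullet> c = 2" and p: "p \<in> sphere 0 1 \<inter> {q. q \<bullet> c = 1}"
  shows "tangent_space (sphere 0 1 \<inter> {q. q \<bullet> c = 1}) p = {v. v \<bullet> p = 0 \<and> v \<bullet> c = 0}"
    (is "tangent_space ?N p = _")
proof (intro equalityI subsetI CollectI conjI)
  fix v assume v: "v \<in> tangent_space ?N p"
  show "v \<bullet> p = 0" using tangent_space_sphere_orthogonal[OF v] by blast
  show "v \<bullet> c = 0" using tangent_space_orthogonal[OF v] by blast
next
  fix v assume v: "v \<in> {v. v \<bullet> p = 0 \<and> v \<bullet> c = 0}"
  have pp: "p \<bullet> p = 1" "p \<bullet> c = 1" using p by (auto simp: dot_square_norm)
  \<comment> \<open>The foot of the perpendicular from the origin to the hyperplane, which is the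
    centre of the small sphere; \<open>z\<close> is the radius vector of \<open>p\<close>.\<close>
  define b where "b = (1/2) *\<^sub>R c"
  define z where "z = p - b"
  have zz: "z \<bullet> z = 1/2" "b \<bullet> z = 0" "b \<bullet> b = 1/2" "b \<bullet> c = 1" "z \<bullet> c = 0" "v \<bullet> z = 0" "v \<bullet> b = 0" "v \<bullet> c = 0"
    using pp v assms(1) by (auto simp: z_def b_def inner_diff_left inner_diff_right inner_commute)
  have "v \<in> tangent_space ?N (b + z)"
  proof (rule tangent_space_circle)
    show "z \<noteq> 0" using zz by auto
    show "v \<bullet> z = 0" by fact
    fix w \<alpha> \<beta> assume w: "w = \<alpha> *\<^sub>R z + \<beta> *\<^sub>R v" "norm w = norm z"
    have "w \<bullet> w = 1/2" using w(2) zz by (simp add: norm_eq)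
    moreover have "w \<bullet> b = 0" "w \<bullet> c = 0" unfolding w using zz by (auto simp: inner_add_left inner_add_right inner_commute)
    ultimately have "(b + w) \<bullet> (b + w) = 1" "(b + w) \<bullet> c = 1"
      using zz by (auto simp: inner_add_left inner_add_right inner_commute)
    then show "b + w \<in> ?N" by (simp add: norm_eq_1)
  qed
  then show "v \<in> tangent_space ?N p" by (simp add: z_def)
qed

section \<open>Projection, connection and curvature of the unit sphere\<close>

lemma subspace_orthogonal: "subspace {v::'e::euclidean_space. v \<bullet> p = 0}"
  by (auto simp: subspace_def inner_add_left)

lemma orth_proj_sphere:
  fixes p :: "'e::euclidean_space"
  assumes "p \<in> sphere 0 1"
  shows "orth_proj (tangent_space (sphere 0 1) p) v = v - (v \<bullet> p) *\<^sub>R p"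
  unfolding tangent_space_sphere[OF assms]
proof (rule orth_proj_eqI[OF subspace_orthogonal])
  show "v - (v \<bullet> p) *\<^sub>R p \<in> {v. v \<bullet> p = 0}"
    using assms by (simp add: inner_diff_left dot_square_norm)
  show "(v - (v - (v \<bullet> p) *\<^sub>R p)) \<bullet> t = 0" if "t \<in> {v. v \<bullet> p = 0}" for t
    using that by (simp add: inner_commute)
qed

text \<open>A field known only on \<open>N\<close> is differentiated through an ambient extension
  \<open>Z\<close>: the chain rule gives \<open>Z' v\<close> along every admissible curve, and
  tangency of \<open>v\<close> provides a curve that makes the value unique.\<close>

lemma dir_deriv_eqI:
  assumes "v \<in> tangent_space N p" "(Z has_derivative Z') (at p)" "\<And>q. q \<in> N \<Longrightarrow> Y q = Z q"
  shows "dir_deriv N Y p v = Z' v"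
  unfolding dir_deriv_def
proof (rule the_equality)
  have D: "((\<lambda>t. Y (\<gamma> t)) has_vector_derivative Z' v) (at 0)"
    if "range \<gamma> \<subseteq> N" "\<gamma> 0 = p" "(\<gamma> has_vector_derivative v) (at 0)" for \<gamma> :: "real \<Rightarrow> 'a"
  proof -
    have "(\<lambda>t. Y (\<gamma> t)) = Z \<circ> \<gamma>" using that assms(3) by (auto simp: fun_eq_iff image_subset_iff)
    moreover have "(Z \<circ> \<gamma> has_derivative Z' \<circ> (\<lambda>t. t *\<^sub>R v)) (at 0)"
      using that assms(2) by (intro diff_chain_at) (auto simp: has_vector_derivative_def)
    moreover have "Z' \<circ> (\<lambda>t. t *\<^sub>R v) = (\<lambda>t. t *\<^sub>R Z' v)"
      using has_derivative_linear[OF assms(2)] by (auto simp: linear_cmul)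
    ultimately show ?thesis by (simp add: has_vector_derivative_def)
  qed
  then show "\<forall>\<gamma>. range \<gamma> \<subseteq> N \<and> \<gamma> 0 = p \<and> (\<gamma> has_vector_derivative v) (at 0)
      \<longrightarrow> ((\<lambda>t. Y (\<gamma> t)) has_vector_derivative Z' v) (at 0)"
    by blast
  fix w assume w: "\<forall>\<gamma>. range \<gamma> \<subseteq> N \<and> \<gamma> 0 = p \<and> (\<gamma> has_vector_derivative v) (at 0)
      \<longrightarrow> ((\<lambda>t. Y (\<gamma> t)) has_vector_derivative w) (at 0)"
  obtain \<gamma> where \<gamma>: "range \<gamma> \<subseteq> N" "\<gamma> 0 = p" "(\<gamma> has_vector_derivative v) (at 0)"
    using assms(1) by (auto simp: tangent_space_def)
  then have "((\<lambda>t. Y (\<gamma> t)) has_vector_derivative w) (at 0)" using w by simp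
  then show "w = Z' v" using D[OF \<gamma>] by (rule vector_derivative_unique_at)
qed

lemma nabla_sphere_proj:
  fixes b c p :: "'e::euclidean_space"
  assumes p: "p \<in> sphere 0 1"
  shows "nabla (sphere 0 1) (\<lambda>q. orth_proj (tangent_space (sphere 0 1) q) b)
      (\<lambda>q. orth_proj (tangent_space (sphere 0 1) q) c) p = - (c \<bullet> p) *\<^sub>R (b - (b \<bullet> p) *\<^sub>R p)"
proof -
  let ?v = "b - (b \<bullet> p) *\<^sub>R p"
  have v: "?v \<bullet> p = 0" using p by (simp add: inner_diff_left dot_square_norm)
  \<comment> \<open>On the sphere the projected field agrees with this quadratic map of the ambient
    space; projecting its derivative then removes the multiple of \<open>p\<close>.\<close>
  have D: "((\<lambda>q. c - (c \<bullet> q) *\<^sub>R q) has_derivative (\<lambda>v. - ((c \<bullet> v) *\<^sub>R p + (c \<bullet> p) *\<^sub>R v))) (at p)"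
    by (auto intro!: derivative_eq_intros)
  then have "dir_deriv (sphere 0 1) (\<lambda>q. orth_proj (tangent_space (sphere 0 1) q) c) p ?v
      = - ((c \<bullet> ?v) *\<^sub>R p + (c \<bullet> p) *\<^sub>R ?v)"
    using v p by (intro dir_deriv_eqI[OF _ D]) (simp_all add: tangent_space_sphere, simp add: orth_proj_sphere flip: tangent_space_sphere)
  moreover have "orth_proj (tangent_space (sphere 0 1) p) (- (\<alpha> *\<^sub>R p + \<beta> *\<^sub>R w)) = - \<beta> *\<^sub>R w"
    if "w \<bullet> p = 0" for \<alpha> \<beta> w
    using p that by (simp add: orth_proj_sphere inner_diff_left dot_square_norm)
  ultimately show ?thesis
    unfolding nabla_def orth_proj_sphere[OF p, of b] using v by simp
qed

text \<open>Constant curvature 1. For the projected extensions the bracket vanishes at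
  \<open>p\<close>, and each iterated covariant derivative reduces there to a single term.\<close>

lemma curvature_sphere:
  fixes a b c p :: "'e::euclidean_space"
  assumes p: "p \<in> sphere 0 1" and "a \<bullet> p = 0" "b \<bullet> p = 0" "c \<bullet> p = 0"
  shows "curvature (sphere 0 1) p a b c = (b \<bullet> c) *\<^sub>R a - (a \<bullet> c) *\<^sub>R b"
proof -
  let ?S = "sphere 0 1 :: 'e set"
  let ?E = "\<lambda>a q. orth_proj (tangent_space ?S q) a"
  have E: "?E d p = d" if "d \<bullet> p = 0" for d using p that by (simp add: orth_proj_sphere)
  have second: "nabla ?S (?E d) (nabla ?S (?E e) (?E c)) p = - (d \<bullet> c) *\<^sub>R e"
    if "d \<bullet> p = 0" "e \<bullet> p = 0" for d e
  proof -
    \<comment> \<open>By \<open>nabla_sphere_proj\<close> the inner covariant derivative agrees on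
      the sphere with this cubic map, which can be differentiated in the ambient space.\<close>
    have D: "((\<lambda>q. - (c \<bullet> q) *\<^sub>R (e - (e \<bullet> q) *\<^sub>R q)) has_derivative
       (\<lambda>v. - ((c \<bullet> v) *\<^sub>R (e - (e \<bullet> p) *\<^sub>R p)) + (c \<bullet> p) *\<^sub>R ((e \<bullet> v) *\<^sub>R p + (e \<bullet> p) *\<^sub>R v))) (at p)"
      by (auto intro!: derivative_eq_intros ext simp: algebra_simps)
    then have "dir_deriv ?S (nabla ?S (?E e) (?E c)) p d
        = - ((c \<bullet> d) *\<^sub>R (e - (e \<bullet> p) *\<^sub>R p)) + (c \<bullet> p) *\<^sub>R ((e \<bullet> d) *\<^sub>R p + (e \<bullet> p) *\<^sub>R d)"
      using that p by (intro dir_deriv_eqI[OF _ D]) (auto simp: tangent_space_sphere nabla_sphere_proj)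
    then show ?thesis
      unfolding nabla_def[of _ _ "nabla _ _ _"] E[OF that(1)]
      using that assms by (simp add: orth_proj_sphere inner_commute)
  qed
  have first: "dir_deriv ?S (?E e) p d = - (e \<bullet> d) *\<^sub>R p" if "d \<bullet> p = 0" "e \<bullet> p = 0" for d e
  proof -
    have D: "((\<lambda>q. e - (e \<bullet> q) *\<^sub>R q) has_derivative (\<lambda>v. - ((e \<bullet> v) *\<^sub>R p + (e \<bullet> p) *\<^sub>R v))) (at p)"
      by (auto intro!: derivative_eq_intros)
    then have "dir_deriv ?S (?E e) p d = - ((e \<bullet> d) *\<^sub>R p + (e \<bullet> p) *\<^sub>R d)"
      using that p by (intro dir_deriv_eqI[OF _ D]) (simp_all add: tangent_space_sphere, simp add: orth_proj_sphere flip: tangent_space_sphere)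
    then show ?thesis using that by simp
  qed
  \<comment> \<open>The value in \<open>first\<close> is symmetric in \<open>d\<close> and
    \<open>e\<close>.\<close>
  have "lie_bracket ?S (?E a) (?E b) p = 0"
    unfolding lie_bracket_def using assms by (simp add: E first inner_commute)
  \<comment> \<open>\<open>nabla\<close> sees only the value at \<open>p\<close> of the field along
    which it differentiates, here 0.\<close>
  then have "nabla ?S (lie_bracket ?S (?E a) (?E b)) (?E c) p = 0"
    unfolding nabla_def using first[of 0 c] assms by (simp add: orth_proj_sphere)
  with second show ?thesis
    unfolding curvature_def curvature_fields_def Let_def using assms by simp
qed

section \<open>Immersions into the unit sphere\<close>

lemma linear_vec_expansion:
  fixes f :: "real^'m \<Rightarrow> 'b::real_vector"
  assumes "linear f"
  shows "f v = (\<Sum>i\<in>UNIV. v $ i *\<^sub>R f (axis i 1))"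
proof -
  have "v = (\<Sum>i\<in>UNIV. v $ i *\<^sub>R axis i 1)"
    using basis_expansion[of v] by (simp add: scalar_mult_eq_scaleR)
  then have "f v = f (\<Sum>i\<in>UNIV. v $ i *\<^sub>R axis i 1)" by simp
  also have "\<dots> = (\<Sum>i\<in>UNIV. v $ i *\<^sub>R f (axis i 1))"
    using assms by (simp add: linear_sum linear_scale)
  finally show ?thesis .
qed

lemma metric_trace_add:
  "metric_trace x u (\<lambda>\<xi> \<zeta>. b \<xi> \<zeta> + b' \<xi> \<zeta>) = metric_trace x u b + metric_trace x u b'"
  by (simp add: metric_trace_def scaleR_add_right sum.distrib)

lemma metric_trace_diff:
  "metric_trace x u (\<lambda>\<xi> \<zeta>. b \<xi> \<zeta> - b' \<xi> \<zeta>) = metric_trace x u b - metric_trace x u b'"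
  by (simp add: metric_trace_def scaleR_diff_right sum_subtractf)

lemma metric_trace_scale:
  "metric_trace x u (\<lambda>\<xi> \<zeta>. c *\<^sub>R b \<xi> \<zeta>) = c *\<^sub>R metric_trace x u b"
  by (simp add: metric_trace_def scaleR_sum_right mult.commute)

lemma metric_trace_inner:
  "metric_trace x u b \<bullet> w
    = (\<Sum>i\<in>UNIV. \<Sum>j\<in>UNIV. matrix_inv (metric_coeffs x u) $ i $ j * (b (axis i 1) (axis j 1) \<bullet> w))"
  by (simp add: metric_trace_def inner_sum_left)

text \<open>Lets a normal contribution to a trace be carried as an unspecified multiple of one
  vector while only the tangential component is examined.\<close>

lemma metric_trace_fixed_direction:
  "\<exists>c. metric_trace x u (\<lambda>\<xi> \<zeta>. q \<xi> \<zeta> *\<^sub>R w) = c *\<^sub>R w"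
  by (simp add: metric_trace_def scaleR_sum_left[symmetric])

lemma metric_coeffs_commute: "metric_coeffs x u $ i $ j = metric_coeffs x u $ j $ i"
  by (simp add: metric_coeffs_def inner_commute)

locale sphere_chart =
  fixes U :: "(real^'m) set" and x :: "real^'m \<Rightarrow> 'e::euclidean_space"
  assumes open_U: "open U" and smooth_x: "smooth_on U x"
    and on_sphere: "\<And>u. u \<in> U \<Longrightarrow> x u \<in> sphere 0 1"
    and immersion: "\<And>u. u \<in> U \<Longrightarrow> inj (push x u)"
begin

abbreviation "ddx u \<xi> \<zeta> \<equiv> frechet_derivative (\<lambda>s. push x s \<zeta>) (at u) \<xi>"
abbreviation "h \<equiv> mean_curv_vector (sphere 0 1) x"
abbreviation "dh u \<equiv> frechet_derivative h (at u)"

lemma has_derivative_x: "u \<in> U \<Longrightarrow> (x has_derivative push x u) (at u)"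
  by (rule smooth_on_has_derivative[OF smooth_x])

lemma smooth_push: "smooth_on U (\<lambda>u. push x u \<zeta>)"
  by (rule smooth_on_frechet_derivative[OF smooth_x])

lemma has_derivative_push: "u \<in> U \<Longrightarrow> ((\<lambda>u. push x u \<zeta>) has_derivative (\<lambda>\<xi>. ddx u \<xi> \<zeta>)) (at u)"
  using smooth_on_has_derivative[OF smooth_push] .

lemma linear_push: "u \<in> U \<Longrightarrow> linear (push x u)"
  by (rule has_derivative_linear[OF has_derivative_x])

lemma subspace_range_push: "u \<in> U \<Longrightarrow> subspace (range (push x u))"
  by (rule linear_subspace_image[OF linear_push subspace_UNIV])

text \<open>The means of differentiating pointwise identities such as
  \<open>x_inner_x\<close>.\<close>

lemma derivative_eq_on_U:
  assumes "u \<in> U" "\<And>s. s \<in> U \<Longrightarrow> f s = g s"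
    and "(f has_derivative f') (at u)" "(g has_derivative g') (at u)"
  shows "f' = g'"
  using has_derivative_transform_within_open[OF assms(3) open_U assms(1,2)] assms(4)
  by (rule has_derivative_unique)

lemma x_inner_x: "u \<in> U \<Longrightarrow> x u \<bullet> x u = 1"
  using on_sphere by (simp add: dot_square_norm)

lemma push_inner_x:
  assumes "u \<in> U" shows "push x u \<xi> \<bullet> x u = 0"
proof -
  have "(\<lambda>\<xi>. x u \<bullet> push x u \<xi> + push x u \<xi> \<bullet> x u) = (\<lambda>\<xi>. 0)"
    by (rule derivative_eq_on_U[OF assms(1) x_inner_x has_derivative_inner has_derivative_const])
      (use has_derivative_x assms in auto)
  then have "x u \<bullet> push x u \<xi> + push x u \<xi> \<bullet> x u = 0" by metis
  then show ?thesis by (simp add: inner_commute)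
qed

text \<open>Obtained by differentiating \<open>push_inner_x\<close>; it is the second fundamental
  form of the unit sphere itself, evaluated on vectors tangent to \<open>M\<close>.\<close>

lemma ddx_inner_x:
  assumes "u \<in> U" shows "ddx u \<xi> \<zeta> \<bullet> x u = - (push x u \<xi> \<bullet> push x u \<zeta>)"
proof -
  have "(\<lambda>\<xi>. push x u \<zeta> \<bullet> push x u \<xi> + ddx u \<xi> \<zeta> \<bullet> x u) = (\<lambda>\<xi>. 0)"
    by (rule derivative_eq_on_U[OF assms(1) push_inner_x has_derivative_inner has_derivative_const])
      (use has_derivative_x has_derivative_push assms in auto)
  then have "push x u \<zeta> \<bullet> push x u \<xi> + ddx u \<xi> \<zeta> \<bullet> x u = 0" by metis
  then show ?thesis by (simp add: inner_commute)
qed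

lemma pullback_conn_sphere:
  assumes "u \<in> U"
  shows "pullback_conn (sphere 0 1) x V u \<xi>
    = frechet_derivative V (at u) \<xi> - (frechet_derivative V (at u) \<xi> \<bullet> x u) *\<^sub>R x u"
  unfolding pullback_conn_def by (rule orth_proj_sphere[OF on_sphere[OF assms]])

section \<open>The inverse metric, gradients and tangential parts\<close>

lemma push_inner_push:
  assumes "u \<in> U"
  shows "push x u (axis i 1) \<bullet> push x u \<theta> = (\<Sum>k\<in>UNIV. metric_coeffs x u $ i $ k * \<theta> $ k)"
  by (subst linear_vec_expansion[OF linear_push[OF assms], of \<theta>])
    (simp add: inner_sum_right metric_coeffs_def mult.commute)

text \<open>A kernel vector \<open>v\<close> of the Gram matrix satisfies |dx v|^2 = 0, and dx is
  injective.\<close>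

lemma invertible_metric_coeffs:
  assumes "u \<in> U" shows "invertible (metric_coeffs x u)"
proof -
  have "v = 0" if "metric_coeffs x u *v v = 0" for v
  proof -
    have "push x u (axis i 1) \<bullet> push x u v = 0" for i
      using that by (simp add: push_inner_push[OF assms] vec_eq_iff matrix_vector_mult_def)
    moreover have "push x u v \<bullet> push x u v = (\<Sum>i\<in>UNIV. v $ i * (push x u (axis i 1) \<bullet> push x u v))"
      by (subst linear_vec_expansion[OF linear_push[OF assms], of v]) (simp add: inner_sum_left)
    ultimately have "push x u v = push x u 0"
      using linear_0[OF linear_push[OF assms]] by simp
    then show "v = 0" using immersion[OF assms] by (simp add: inj_eq)
  qed
  then show ?thesis using matrix_left_invertible_ker invertible_left_inverse by blast
qed

abbreviation "ginv u \<equiv> matrix_inv (metric_coeffs x u)"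

lemma ginv_inverse:
  assumes "u \<in> U"
  shows "metric_coeffs x u ** ginv u = mat 1" "ginv u ** metric_coeffs x u = mat 1"
  using someI_ex[OF invertible_metric_coeffs[OF assms, unfolded invertible_def]]
  by (simp_all add: matrix_inv_def)

lemma ginv_metric:
  assumes "u \<in> U"
  shows "(\<Sum>j\<in>UNIV. ginv u $ i $ j * metric_coeffs x u $ j $ k) = (if i = k then 1 else 0)"
proof -
  have "(ginv u ** metric_coeffs x u) $ i $ k = mat 1 $ i $ k" using ginv_inverse[OF assms] by simp
  then show ?thesis by (simp add: matrix_matrix_mult_def mat_def)
qed

text \<open>The transpose of the inverse is a left inverse of the symmetric matrix, and inverses are
  unique.\<close>

lemma ginv_commute:
  assumes "u \<in> U" shows "ginv u $ i $ j = ginv u $ j $ i"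
proof -
  have "transpose (metric_coeffs x u) = metric_coeffs x u"
    by (simp add: vec_eq_iff transpose_def metric_coeffs_commute)
  then have "transpose (ginv u) ** metric_coeffs x u = mat 1"
    using matrix_transpose_mul[of "metric_coeffs x u" "ginv u"] ginv_inverse(1)[OF assms]
    by (simp add: transpose_mat)
  then have "transpose (ginv u) = ginv u"
    using matrix_mul_assoc[of "transpose (ginv u)" "metric_coeffs x u" "ginv u"] ginv_inverse(1)[OF assms]
    by simp
  then have "transpose (ginv u) $ j $ i = ginv u $ j $ i" by simp
  then show ?thesis by (simp add: transpose_def)
qed

lemma metric_trace_commute:
  assumes "u \<in> U"
  shows "metric_trace x u (\<lambda>\<xi> \<zeta>. b \<zeta> \<xi>) = metric_trace x u b"
  unfolding metric_trace_def by (subst sum.swap, subst ginv_commute[OF assms]) simp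

lemma metric_trace_metric:
  assumes "u \<in> U"
  shows "metric_trace x u (\<lambda>\<xi> \<zeta>. (push x u \<xi> \<bullet> push x u \<zeta>) *\<^sub>R w) = real CARD('m) *\<^sub>R w"
proof -
  have "(\<Sum>i\<in>UNIV. \<Sum>j\<in>UNIV. ginv u $ i $ j * (push x u (axis i 1) \<bullet> push x u (axis j 1)))
    = (\<Sum>i\<in>(UNIV::'m set). \<Sum>j\<in>UNIV. ginv u $ i $ j * metric_coeffs x u $ j $ i)"
    by (simp add: metric_coeffs_def inner_commute)
  also have "\<dots> = real CARD('m)" by (simp add: ginv_metric[OF assms])
  finally show ?thesis by (simp add: metric_trace_def scaleR_sum_left[symmetric])
qed

text \<open>The trace is the metric gradient of the 1-form \<open>\<alpha>\<close>: raising and then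
  lowering the index cancels by \<open>ginv_metric\<close>.\<close>

lemma metric_trace_gradient:
  assumes u: "u \<in> U" and \<alpha>: "linear \<alpha>"
  shows "metric_trace x u (\<lambda>\<xi> \<zeta>. \<alpha> \<xi> *\<^sub>R push x u \<zeta>) \<bullet> push x u \<theta> = \<alpha> \<theta>"
proof -
  have "metric_trace x u (\<lambda>\<xi> \<zeta>. \<alpha> \<xi> *\<^sub>R push x u \<zeta>) \<bullet> push x u \<theta>
     = (\<Sum>i\<in>UNIV. \<Sum>j\<in>UNIV. \<Sum>k\<in>UNIV. \<alpha> (axis i 1) * \<theta> $ k * (ginv u $ i $ j * metric_coeffs x u $ j $ k))"
    unfolding metric_trace_inner inner_scaleR_left push_inner_push[OF u]
    by (simp add: sum_distrib_left mult_ac)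
  also have "\<dots> = (\<Sum>i\<in>UNIV. \<Sum>k\<in>UNIV. \<alpha> (axis i 1) * \<theta> $ k * (\<Sum>j\<in>UNIV. ginv u $ i $ j * metric_coeffs x u $ j $ k))"
    by (rule sum.cong[OF refl], subst sum.swap) (simp add: sum_distrib_left)
  also have "\<dots> = (\<Sum>i\<in>UNIV. \<theta> $ i *\<^sub>R \<alpha> (axis i 1))"
    by (simp add: ginv_metric[OF u] if_distrib cong: if_cong) (simp add: mult.commute)
  also have "\<dots> = \<alpha> \<theta>" by (rule linear_vec_expansion[OF \<alpha>, symmetric])
  finally show ?thesis .
qed

lemma
  assumes "u \<in> U"
  shows linear_tan_part: "linear (tan_part x u)"
    and tan_part_mem: "tan_part x u w \<in> range (push x u)"
    and tan_part_inner: "tan_part x u w \<bullet> push x u \<theta> = w \<bullet> push x u \<theta>"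
    and tan_part_zero: "(\<And>\<theta>. w \<bullet> push x u \<theta> = 0) \<Longrightarrow> tan_part x u w = 0"
  using subspace_range_push[OF assms] unfolding tan_part_def
  by (auto simp: orth_proj_mem orth_proj_inner intro: linear_orth_proj orth_proj_zero)

text \<open>The tangential part is the gradient of the form
  \<open>\<lambda>\<theta>. w \<bullet> push x u \<theta>\<close>. Written explicitly in the inverse
  metric, it visibly depends smoothly on \<open>u\<close>.\<close>

lemma tan_part_eq_sum:
  assumes u: "u \<in> U"
  shows "tan_part x u w = (\<Sum>k\<in>UNIV. \<Sum>l\<in>UNIV. (ginv u $ k $ l * (w \<bullet> push x u (axis k 1))) *\<^sub>R push x u (axis l 1))"
    (is "_ = ?y")
proof -
  let ?\<alpha> = "\<lambda>\<theta>. w \<bullet> push x u \<theta>"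
  have y: "?y = metric_trace x u (\<lambda>\<xi> \<zeta>. ?\<alpha> \<xi> *\<^sub>R push x u \<zeta>)"
    by (simp add: metric_trace_def)
  have \<alpha>: "linear ?\<alpha>"
    using linear_compose[OF linear_push[OF u] bounded_linear.linear[OF bounded_linear_inner_right, of w]]
    by (simp add: o_def)
  show ?thesis unfolding tan_part_def
  proof (rule orth_proj_eqI[OF subspace_range_push[OF u]])
    show "?y \<in> range (push x u)"
      by (intro subspace_sum subspace_scale subspace_range_push[OF u] rangeI)
    show "(w - ?y) \<bullet> t = 0" if "t \<in> range (push x u)" for t
      using that metric_trace_gradient[OF u \<alpha>] unfolding y by (auto simp: inner_diff_left)
  qed
qed

section \<open>Second fundamental form and mean curvature vector in the sphere\<close>

lemma second_ff_inner_push: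
  "u \<in> U \<Longrightarrow> second_ff (sphere 0 1) x u \<xi> \<zeta> \<bullet> push x u \<theta> = 0"
  by (simp add: second_ff_def Let_def inner_diff_left tan_part_inner)

text \<open>Pairing with \<open>w\<close> normal to the image of dx removes the tangential part; the
  metric term comes from projecting onto the sphere, because \<open>w\<close> may still have a
  component along \<open>x u\<close>.\<close>

lemma second_ff_inner:
  assumes "u \<in> U" "\<And>\<theta>. push x u \<theta> \<bullet> w = 0"
  shows "second_ff (sphere 0 1) x u \<xi> \<zeta> \<bullet> w
    = ddx u \<xi> \<zeta> \<bullet> w + (push x u \<xi> \<bullet> push x u \<zeta>) * (x u \<bullet> w)"
proof -
  have "tan_part x u v \<bullet> w = 0" for v using tan_part_mem[OF assms(1), of v] assms(2) by auto
  then show ?thesis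
    using assms(1) by (simp add: second_ff_def Let_def inner_diff_left inner_add_left pullback_conn_sphere ddx_inner_x)
qed

lemma h_inner: "real CARD('m) * (h u \<bullet> w) = metric_trace x u (second_ff (sphere 0 1) x u) \<bullet> w"
  by (simp add: mean_curv_vector_def)

lemma h_inner_eq_0:
  assumes "\<And>\<xi> \<zeta>. second_ff (sphere 0 1) x u \<xi> \<zeta> \<bullet> w = 0"
  shows "h u \<bullet> w = 0"
  using h_inner[of u w] by (simp add: metric_trace_inner assms)

lemma h_inner_push: "u \<in> U \<Longrightarrow> h u \<bullet> push x u \<theta> = 0"
  by (intro h_inner_eq_0 second_ff_inner_push)

text \<open>For \<open>w = x u\<close> the two terms of \<open>second_ff_inner\<close>
  cancel.\<close>

lemma h_inner_x: "u \<in> U \<Longrightarrow> h u \<bullet> x u = 0"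
  by (intro h_inner_eq_0) (simp add: second_ff_inner push_inner_x ddx_inner_x x_inner_x)

text \<open>Beltrami's formula tested on normal vectors: up to tangential terms, the trace of the
  second derivative of \<open>x\<close> is m (h - x).\<close>

lemma metric_trace_ddx_inner:
  assumes "u \<in> U" "\<And>\<theta>. push x u \<theta> \<bullet> w = 0"
  shows "metric_trace x u (ddx u) \<bullet> w = real CARD('m) * (h u \<bullet> w) - real CARD('m) * (x u \<bullet> w)"
proof -
  have "metric_trace x u (second_ff (sphere 0 1) x u) \<bullet> w
    = metric_trace x u (\<lambda>\<xi> \<zeta>. ddx u \<xi> \<zeta> + (push x u \<xi> \<bullet> push x u \<zeta>) *\<^sub>R x u) \<bullet> w"
    by (simp add: metric_trace_inner second_ff_inner[OF assms] inner_add_left)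
  then show ?thesis
    by (simp add: h_inner metric_trace_add metric_trace_metric[OF assms(1)] inner_add_left)
qed

text \<open>\<open>h\<close> is defined through projections given by \<open>THE\<close>; smoothness
  is read off once these are rewritten in terms of \<open>x\<close>, its derivatives and the inverse
  metric.\<close>

lemma smooth_h: "smooth_on U h"
proof -
  let ?S = "sphere 0 1 :: 'e set"
  let ?X = "\<lambda>i u. push x u (axis i 1)"
  let ?P = "\<lambda>i j u. ddx u (axis i 1) (axis j 1) - (ddx u (axis i 1) (axis j 1) \<bullet> x u) *\<^sub>R x u"
  have ginv: "smooth_on U (\<lambda>u. ginv u $ k $ l)" for k l
    by (rule smooth_on_matrix_inv[OF open_U _ invertible_metric_coeffs])
      (auto simp: metric_coeffs_def intro: smooth_on_inner open_U smooth_push)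
  have P: "smooth_on U (?P i j)" for i j
    by (intro smooth_on_diff smooth_on_scaleR smooth_on_inner open_U smooth_x
        smooth_on_frechet_derivative smooth_push)
  have II: "smooth_on U (\<lambda>u. ?P i j u - (\<Sum>k\<in>UNIV. \<Sum>l\<in>UNIV. (ginv u $ k $ l * (?P i j u \<bullet> ?X k u)) *\<^sub>R ?X l u))" for i j
    by (rule smooth_on_diff[OF open_U P], rule smooth_on_sum[OF open_U], rule smooth_on_sum[OF open_U],
        rule smooth_on_scaleR[OF open_U smooth_on_mult[OF open_U ginv smooth_on_inner[OF open_U P smooth_push]] smooth_push])
  have "smooth_on U (\<lambda>u. second_ff ?S x u (axis i 1) (axis j 1))" for i j
    by (rule smooth_on_cong[OF open_U, THEN iffD2, OF _ II])
      (simp add: second_ff_def Let_def tan_part_eq_sum pullback_conn_sphere)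
  then have "smooth_on U (\<lambda>u. (1 / real CARD('m)) *\<^sub>R
      (\<Sum>i\<in>UNIV. \<Sum>j\<in>UNIV. ginv u $ i $ j *\<^sub>R second_ff ?S x u (axis i 1) (axis j 1)))"
    by (intro smooth_on_scaleR smooth_on_sum open_U smooth_on_const ginv)
  then show ?thesis
    by (simp add: mean_curv_vector_def[abs_def] metric_trace_def[abs_def])
qed

lemma has_derivative_h: "u \<in> U \<Longrightarrow> (h has_derivative dh u) (at u)"
  by (rule smooth_on_has_derivative[OF smooth_h])

text \<open>Differentiate \<open>h_inner_x\<close> and use that \<open>h\<close> is normal to
  \<open>M\<close>. Consequently the connection of the sphere acts on \<open>h\<close> as the plain
  derivative.\<close>

lemma dh_inner_x:
  assumes "u \<in> U" shows "dh u \<xi> \<bullet> x u = 0"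
proof -
  have "(\<lambda>\<xi>. h u \<bullet> push x u \<xi> + dh u \<xi> \<bullet> x u) = (\<lambda>\<xi>. 0)"
    by (rule derivative_eq_on_U[OF assms(1) h_inner_x has_derivative_inner has_derivative_const])
      (use has_derivative_x has_derivative_h assms in auto)
  then have "h u \<bullet> push x u \<xi> + dh u \<xi> \<bullet> x u = 0" by metis
  then show ?thesis using h_inner_push assms by simp
qed

lemma pullback_conn_h: "u \<in> U \<Longrightarrow> pullback_conn (sphere 0 1) x h u \<xi> = dh u \<xi>"
  by (simp add: pullback_conn_sphere dh_inner_x)

text \<open>Justifies the \<open>THE\<close>: tangential parts lie in the range of dx, and dx is
  injective.\<close>

lemma push_levi_civita:
  assumes "u \<in> U"
  shows "push x u (levi_civita (sphere 0 1) x u \<xi> \<eta>)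
    = tan_part x u (pullback_conn (sphere 0 1) x (\<lambda>s. push x s \<eta>) u \<xi>)" (is "_ = ?w")
proof -
  obtain \<zeta> where \<zeta>: "push x u \<zeta> = ?w" using tan_part_mem[OF assms] by (metis rangeE)
  show ?thesis unfolding levi_civita_def
    by (rule theI[where P = "\<lambda>\<zeta>. push x u \<zeta> = ?w", OF \<zeta>]) (use \<zeta> immersion[OF assms] in \<open>metis injD\<close>)
qed

end

section \<open>PNMC pseudo-umbilical biharmonic immersions\<close>

locale pnmc_chart = sphere_chart U x for U :: "(real^'m) set" and x :: "real^'m \<Rightarrow> 'e::euclidean_space" +
  assumes mean_curvature_pos: "\<And>u. u \<in> U \<Longrightarrow> mean_curvature (sphere 0 1) x u > 0"
    and parallel: "\<And>u \<xi>. u \<in> U \<Longrightarrow>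
      normal_conn (sphere 0 1) x (\<lambda>s. (1 / mean_curvature (sphere 0 1) x s) *\<^sub>R h s) u \<xi> = 0"
    and umbilical: "\<And>u \<xi>. u \<in> U \<Longrightarrow>
      weingarten (sphere 0 1) x h u \<xi> = (mean_curvature (sphere 0 1) x u)\<^sup>2 *\<^sub>R push x u \<xi>"
    and biharmonic_eq: "\<And>u. u \<in> U \<Longrightarrow> rough_laplacian (sphere 0 1) x h u
      + metric_trace x u (\<lambda>\<xi> \<eta>. curvature (sphere 0 1) (x u) (push x u \<xi>) (h u) (push x u \<eta>)) = 0"
begin

section \<open>First derivative of the mean curvature vector\<close>

abbreviation "F u \<equiv> h u \<bullet> h u"

text \<open>This is d(log |h|), as the derivative of \<open>F\<close> is twice dh \<bullet> h; the
  quotient form involves only operations already known to preserve smoothness.\<close>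

definition "dlogf u \<xi> = (dh u \<xi> \<bullet> h u) * inverse (F u)"

lemma F_pos: "u \<in> U \<Longrightarrow> F u > 0"
  using mean_curvature_pos[of u] by (simp add: mean_curvature_def)

text \<open>Parallelism of h/|h| makes the normal part of dh a multiple of \<open>h\<close>, and
  pseudo-umbilicity fixes the tangential part. Pairing with \<open>h\<close> identifies the
  multiple.\<close>

lemma dh_eq:
  assumes u: "u \<in> U"
  shows "dh u \<xi> = dlogf u \<xi> *\<^sub>R h u - F u *\<^sub>R push x u \<xi>"
proof -
  let ?f = "\<lambda>s. mean_curvature (sphere 0 1) x s"
  let ?T = "tan_part x u"
  have f: "?f u \<noteq> 0" "?f = (\<lambda>s. norm (h s))" "(?f u)\<^sup>2 = F u"
    using mean_curvature_pos[OF u] by (auto simp: mean_curvature_def fun_eq_iff power2_norm_eq_inner)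
  have hnz: "h u \<noteq> 0" using F_pos[OF u] by auto
  have "(\<lambda>s. 1 / ?f s) differentiable (at u)"
  proof -
    have "(\<lambda>s. norm (h s)) differentiable (at u)"
      using has_derivative_compose[OF has_derivative_h[OF u] has_derivative_norm[OF hnz]]
      unfolding differentiable_def by blast
    then show ?thesis using f(1) unfolding f(2) by (intro differentiable_divide) auto
  qed
  \<comment> \<open>An explicit formula for \<open>c\<close> is avoided: its value is recovered
    below by pairing with \<open>h u\<close>.\<close>
  then obtain c where c: "((\<lambda>s. 1 / ?f s) has_derivative c) (at u)" unfolding differentiable_def by blast
  have "((\<lambda>s. (1 / ?f s) *\<^sub>R h s) has_derivative (\<lambda>\<xi>. (1 / ?f u) *\<^sub>R dh u \<xi> + c \<xi> *\<^sub>R h u)) (at u)"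
    by (rule has_derivative_scaleR[OF c has_derivative_h[OF u]])
  then have "frechet_derivative (\<lambda>s. (1 / ?f s) *\<^sub>R h s) (at u) \<xi> = (1 / ?f u) *\<^sub>R dh u \<xi> + c \<xi> *\<^sub>R h u"
    by (rule frechet_derivative_apply)
  then have "pullback_conn (sphere 0 1) x (\<lambda>s. (1 / ?f s) *\<^sub>R h s) u \<xi> = (1 / ?f u) *\<^sub>R dh u \<xi> + c \<xi> *\<^sub>R h u"
    by (simp add: pullback_conn_sphere[OF u] inner_add_left dh_inner_x[OF u] h_inner_x[OF u])
  moreover have "?T (h u) = 0" using h_inner_push[OF u] by (rule tan_part_zero[OF u])
  moreover have "?T (dh u \<xi>) = - F u *\<^sub>R push x u \<xi>"
    using arg_cong[OF umbilical[OF u, of \<xi>], of uminus]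
    by (simp add: weingarten_def pullback_conn_h[OF u] f(3))
  ultimately have "(1 / ?f u) *\<^sub>R dh u \<xi> + c \<xi> *\<^sub>R h u + (1 / ?f u) *\<^sub>R F u *\<^sub>R push x u \<xi> = 0"
    using parallel[OF u, of \<xi>] unfolding normal_conn_def Let_def
    by (simp add: linear_add[OF linear_tan_part[OF u]] linear_scale[OF linear_tan_part[OF u]])
  then have "?f u *\<^sub>R ((1 / ?f u) *\<^sub>R dh u \<xi> + c \<xi> *\<^sub>R h u + (1 / ?f u) *\<^sub>R F u *\<^sub>R push x u \<xi>) = 0"
    by simp
  then have "dh u \<xi> + (?f u * c \<xi>) *\<^sub>R h u + F u *\<^sub>R push x u \<xi> = 0"
    using f(1) by (simp add: scaleR_add_right)
  then have dh: "dh u \<xi> = - (?f u * c \<xi>) *\<^sub>R h u - F u *\<^sub>R push x u \<xi>"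
    by (simp add: algebra_simps eq_neg_iff_add_eq_0)
  then have "dh u \<xi> \<bullet> h u = - (?f u * c \<xi>) * F u"
    by (simp add: inner_diff_left inner_commute[of "push x u \<xi>"] h_inner_push[OF u])
  then have "dlogf u \<xi> = - (?f u * c \<xi>)" using F_pos[OF u] by (simp add: dlogf_def)
  with dh show ?thesis by simp
qed

lemma smooth_dlogf: "smooth_on U (\<lambda>u. dlogf u \<xi>)"
  unfolding dlogf_def using F_pos
  by (intro smooth_on_mult smooth_on_inner smooth_on_inverse smooth_on_frechet_derivative open_U smooth_h)
    auto

lemma linear_dh: "u \<in> U \<Longrightarrow> linear (dh u)"
  by (rule has_derivative_linear[OF has_derivative_h])

lemma linear_dlogf:
  assumes "u \<in> U" shows "linear (dlogf u)"
  by (rule linearI) (auto simp: dlogf_def linear_add[OF linear_dh[OF assms]] linear_scale[OF linear_dh[OF assms]]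
      inner_add_left distrib_right)

section \<open>Second covariant derivative of \<open>h\<close> and the biharmonic equation\<close>

lemma has_derivative_F:
  assumes "u \<in> U" shows "(F has_derivative (\<lambda>\<xi>. 2 * F u * dlogf u \<xi>)) (at u)"
proof -
  have "(\<lambda>\<xi>. h u \<bullet> dh u \<xi> + dh u \<xi> \<bullet> h u) = (\<lambda>\<xi>. 2 * F u * dlogf u \<xi>)"
    using F_pos[OF assms] by (auto simp: dlogf_def inner_commute)
  then show ?thesis
    using has_derivative_inner[OF has_derivative_h[OF assms] has_derivative_h[OF assms]] by simp
qed

text \<open>The product rule applied to \<open>dh_eq\<close>, with \<open>dh_eq\<close> inserted
  once more. The coefficient \<open>q\<close> is the Hessian of log |h| plus the square of its
  differential; the factor 2 comes from \<open>has_derivative_F\<close>.\<close>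

lemma second_cov_deriv_h:
  assumes u: "u \<in> U"
  defines "q \<equiv> \<lambda>\<xi> \<eta>. frechet_derivative (\<lambda>s. dlogf s \<eta>) (at u) \<xi> + dlogf u \<xi> * dlogf u \<eta>
      - dlogf u (levi_civita (sphere 0 1) x u \<xi> \<eta>)"
  shows "second_cov_deriv (sphere 0 1) x h u \<xi> \<eta> = q \<xi> \<eta> *\<^sub>R h u
    - F u *\<^sub>R (dlogf u \<eta> *\<^sub>R push x u \<xi>) - (2 * F u) *\<^sub>R (dlogf u \<xi> *\<^sub>R push x u \<eta>)
    - F u *\<^sub>R second_ff (sphere 0 1) x u \<xi> \<eta>"
proof -
  let ?S = "sphere 0 1 :: 'e set"
  let ?a' = "frechet_derivative (\<lambda>s. dlogf s \<eta>) (at u)"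
  let ?P = "\<lambda>w. w - (w \<bullet> x u) *\<^sub>R x u"
  let ?D = "\<lambda>\<xi>. (dlogf u \<eta> *\<^sub>R dh u \<xi> + ?a' \<xi> *\<^sub>R h u) - (F u *\<^sub>R ddx u \<xi> \<eta> + (2 * F u * dlogf u \<xi>) *\<^sub>R push x u \<eta>)"
  have "((\<lambda>s. dlogf s \<eta> *\<^sub>R h s - F s *\<^sub>R push x s \<eta>) has_derivative ?D) (at u)"
    by (intro has_derivative_diff has_derivative_scaleR has_derivative_h has_derivative_push
        has_derivative_F u smooth_on_has_derivative[OF smooth_dlogf])
  then have "((\<lambda>s. pullback_conn ?S x h s \<eta>) has_derivative ?D) (at u)"
    by (rule has_derivative_transform_within_open[OF _ open_U u]) (simp add: pullback_conn_h dh_eq)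
  then have "frechet_derivative (\<lambda>s. pullback_conn ?S x h s \<eta>) (at u) \<xi> = ?D \<xi>"
    by (rule frechet_derivative_apply)
  then have 1: "pullback_conn ?S x (\<lambda>s. pullback_conn ?S x h s \<eta>) u \<xi> = ?P (?D \<xi>)"
    by (simp only: pullback_conn_sphere[OF u])
  have 2: "?P (?D \<xi>) = dlogf u \<eta> *\<^sub>R dh u \<xi> + ?a' \<xi> *\<^sub>R h u
      - F u *\<^sub>R ?P (ddx u \<xi> \<eta>) - (2 * F u * dlogf u \<xi>) *\<^sub>R push x u \<eta>"
    by (simp add: inner_diff_left inner_add_left dh_inner_x[OF u] h_inner_x[OF u] push_inner_x[OF u] scaleR_diff_right)
  \<comment> \<open>Gauss formula. The Levi-Civita part cancels against the tangential part of the
    correction term in \<open>second_cov_deriv\<close>.\<close>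
  have 3: "?P (ddx u \<xi> \<eta>) = push x u (levi_civita ?S x u \<xi> \<eta>) + second_ff ?S x u \<xi> \<eta>"
    by (simp add: push_levi_civita[OF u] second_ff_def Let_def pullback_conn_sphere[OF u])
  show ?thesis
    unfolding second_cov_deriv_def trans[OF 1 2] pullback_conn_h[OF u] q_def
    unfolding 3 dh_eq[OF u]
    by (simp add: algebra_simps)
qed

text \<open>In curvature 1, with \<open>h\<close> normal to \<open>M\<close>, the curvature term is
  minus the metric times \<open>h\<close>; its trace turns the biharmonic equation into this
  identity.\<close>

lemma metric_trace_second_cov_deriv_h:
  assumes u: "u \<in> U"
  shows "metric_trace x u (second_cov_deriv (sphere 0 1) x h u) = - real CARD('m) *\<^sub>R h u"
proof -
  have "curvature (sphere 0 1) (x u) (push x u \<xi>) (h u) (push x u \<eta>)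
      = - 1 *\<^sub>R ((push x u \<xi> \<bullet> push x u \<eta>) *\<^sub>R h u)" for \<xi> \<eta>
    using curvature_sphere[OF on_sphere[OF u] push_inner_x[OF u] h_inner_x[OF u] push_inner_x[OF u]]
    by (simp add: h_inner_push[OF u])
  then have "metric_trace x u (\<lambda>\<xi> \<eta>. curvature (sphere 0 1) (x u) (push x u \<xi>) (h u) (push x u \<eta>))
    = - 1 *\<^sub>R (real CARD('m) *\<^sub>R h u)"
    by (simp only: metric_trace_scale metric_trace_metric[OF u])
  then show ?thesis
    using biharmonic_eq[OF u] unfolding rough_laplacian_def by (simp add: eq_neg_iff_add_eq_0 neg_eq_iff_add_eq_0)
qed

lemma metric_trace_second_ff: "metric_trace x u (second_ff (sphere 0 1) x u) = real CARD('m) *\<^sub>R h u"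
  by (simp add: mean_curv_vector_def)

text \<open>The two gradient terms of \<open>second_cov_deriv_h\<close> have the same trace by
  symmetry of the inverse metric, whence F + 2F = 3F.\<close>

lemma trace_second_cov_deriv_h:
  assumes u: "u \<in> U"
  defines "q \<equiv> \<lambda>\<xi> \<eta>. frechet_derivative (\<lambda>s. dlogf s \<eta>) (at u) \<xi> + dlogf u \<xi> * dlogf u \<eta>
      - dlogf u (levi_civita (sphere 0 1) x u \<xi> \<eta>)"
  shows "metric_trace x u (\<lambda>\<xi> \<eta>. q \<xi> \<eta> *\<^sub>R h u)
    - (3 * F u) *\<^sub>R metric_trace x u (\<lambda>\<xi> \<eta>. dlogf u \<xi> *\<^sub>R push x u \<eta>)
    - F u *\<^sub>R (real CARD('m) *\<^sub>R h u) = - real CARD('m) *\<^sub>R h u"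
proof -
  let ?G = "metric_trace x u (\<lambda>\<xi> \<eta>. dlogf u \<xi> *\<^sub>R push x u \<eta>)"
  have G': "metric_trace x u (\<lambda>\<xi> \<eta>. dlogf u \<eta> *\<^sub>R push x u \<xi>) = ?G"
    by (rule metric_trace_commute[OF u])
  have "metric_trace x u (second_cov_deriv (sphere 0 1) x h u)
    = metric_trace x u (\<lambda>\<xi> \<eta>. q \<xi> \<eta> *\<^sub>R h u) - F u *\<^sub>R ?G - (2 * F u) *\<^sub>R ?G - F u *\<^sub>R (real CARD('m) *\<^sub>R h u)"
    unfolding second_cov_deriv_h[OF u, abs_def] metric_trace_diff metric_trace_scale G'
      metric_trace_second_ff q_def ..
  moreover have "(3 * F u) *\<^sub>R ?G = F u *\<^sub>R ?G + (2 * F u) *\<^sub>R ?G"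
    by (simp flip: scaleR_add_left)
  ultimately show ?thesis
    using metric_trace_second_cov_deriv_h[OF u] by (simp add: algebra_simps)
qed

text \<open>Pairing the trace identity with a tangent vector kills every multiple of
  \<open>h\<close> and leaves only the gradient term.\<close>

lemma dlogf_eq_0:
  assumes u: "u \<in> U"
  shows "dlogf u \<theta> = 0"
proof -
  obtain c where c: "metric_trace x u (\<lambda>\<xi> \<eta>. (frechet_derivative (\<lambda>s. dlogf s \<eta>) (at u) \<xi> + dlogf u \<xi> * dlogf u \<eta>
      - dlogf u (levi_civita (sphere 0 1) x u \<xi> \<eta>)) *\<^sub>R h u) = c *\<^sub>R h u"
    by (rule exE[OF metric_trace_fixed_direction])
  have "(3 * F u) * dlogf u \<theta> = 0"
    using arg_cong[OF trace_second_cov_deriv_h[OF u], of "\<lambda>w. w \<bullet> push x u \<theta>"]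
      metric_trace_gradient[OF u linear_dlogf[OF u], of \<theta>]
    unfolding c by (simp add: inner_diff_left h_inner_push[OF u])
  then show ?thesis using F_pos[OF u] by simp
qed

text \<open>\<open>dlogf\<close> vanishes on all of \<open>U\<close>, so its derivatives vanish as
  well; the trace identity shrinks to m F h = m h with \<open>h u\<close> nonzero.\<close>

lemma F_eq_1:
  assumes u: "u \<in> U"
  shows "F u = 1"
proof -
  have "frechet_derivative (\<lambda>s. dlogf s \<eta>) (at u) = (\<lambda>\<xi>. 0)" for \<eta>
    using derivative_eq_on_U[OF u _ smooth_on_has_derivative[OF smooth_dlogf u] has_derivative_const]
      dlogf_eq_0 by blast
  then have "- F u *\<^sub>R (real CARD('m) *\<^sub>R h u) = - real CARD('m) *\<^sub>R h u"
    using trace_second_cov_deriv_h[OF u] dlogf_eq_0[OF u]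
    by (simp add: metric_trace_def)
  moreover have "h u \<noteq> 0" using F_pos[OF u] by auto
  ultimately show ?thesis by simp
qed

section \<open>The vector \<open>x + h\<close>, twice the Euclidean centre of the small
  hypersphere\<close>

lemma has_derivative_center:
  assumes u: "u \<in> U"
  shows "((\<lambda>s. x s + h s) has_derivative (\<lambda>\<xi>. 0)) (at u)"
proof -
  have "dh u \<xi> = - push x u \<xi>" for \<xi>
    using dh_eq[OF u] dlogf_eq_0[OF u] F_eq_1[OF u] by simp
  then show ?thesis
    using has_derivative_add[OF has_derivative_x[OF u] has_derivative_h[OF u]] by simp
qed

text \<open>A vanishing derivative gives constancy on connected sets, so a ball is taken;
  \<open>U\<close> may be disconnected.\<close>

lemma center_locally_constant:
  assumes u: "u \<in> U"
  obtains W where "open W" "u \<in> W" "W \<subseteq> U" "\<And>s. s \<in> W \<Longrightarrow> x s + h s = x u + h u"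
proof -
  obtain e where e: "e > 0" "ball u e \<subseteq> U" using open_U u openE by blast
  have const: "x s + h s = x u + h u" if "s \<in> ball u e" for s
    by (rule has_derivative_zero_unique_connected[OF open_ball connected_ball has_derivative_center that])
      (use e in auto)
  show thesis by (rule that[OF open_ball _ e(2) const]) (use e in auto)
qed

lemma center_inner:
  assumes "u \<in> U"
  shows "(x u + h u) \<bullet> (x u + h u) = 2" "x u \<bullet> (x u + h u) = 1"
  using x_inner_x[OF assms] h_inner_x[OF assms] F_eq_1[OF assms]
  by (simp_all add: inner_add_left inner_add_right inner_commute)

text \<open>Differentiating \<open>x s \<bullet> c = 1\<close> twice makes the trace of the second
  derivative of \<open>x\<close> orthogonal to \<open>c\<close>, so
  \<open>metric_trace_ddx_inner\<close> gives h \<bullet> c = x \<bullet> c = 1. This characterizes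
  x + h by the image of \<open>x\<close> alone, which makes charts comparable.\<close>

lemma center_unique:
  assumes W: "open W" "u \<in> W" "W \<subseteq> U" and "c \<bullet> c = 2" "\<And>s. s \<in> W \<Longrightarrow> x s \<bullet> c = 1"
  shows "c = x u + h u"
proof -
  have push: "push x s \<theta> \<bullet> c = 0" if "s \<in> W" for s \<theta>
  proof -
    have "((\<lambda>s. x s \<bullet> c) has_derivative (\<lambda>\<theta>. push x s \<theta> \<bullet> c)) (at s)"
      using has_derivative_x W that by (intro has_derivative_inner_left) auto
    from has_derivative_transform_within_open[OF this W(1) that assms(5)]
    have "(\<lambda>\<theta>. push x s \<theta> \<bullet> c) = (\<lambda>\<theta>. 0)" by (rule has_derivative_unique) simp_all
    then show ?thesis by metis
  qed
  have u: "u \<in> U" using W by blast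
  have ddx: "ddx u \<xi> \<zeta> \<bullet> c = 0" for \<xi> \<zeta>
  proof -
    have "((\<lambda>s. push x s \<zeta> \<bullet> c) has_derivative (\<lambda>\<xi>. ddx u \<xi> \<zeta> \<bullet> c)) (at u)"
      by (intro has_derivative_inner_left has_derivative_push u)
    from has_derivative_transform_within_open[OF this W(1,2) push]
    have "(\<lambda>\<xi>. ddx u \<xi> \<zeta> \<bullet> c) = (\<lambda>\<theta>. 0)" by (rule has_derivative_unique) simp_all
    then show ?thesis by metis
  qed
  have "metric_trace x u (ddx u) \<bullet> c = 0" by (simp add: metric_trace_inner ddx)
  then have "h u \<bullet> c = x u \<bullet> c"
    using metric_trace_ddx_inner[OF u push[OF W(2)]] by simp
  then have "c \<bullet> (x u + h u) = 2"
    using assms(5)[OF W(2)] by (simp add: inner_add_right inner_commute)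
  \<comment> \<open>The equality case of Cauchy-Schwarz.\<close>
  moreover have "c = t" if "c \<bullet> t = 2" "t \<bullet> t = 2" for t
  proof -
    have "(c - t) \<bullet> (c - t) = 0" using that assms(4) by (simp add: inner_diff_left inner_diff_right inner_commute)
    then show ?thesis by simp
  qed
  ultimately show ?thesis using center_inner(1)[OF u] by blast
qed

text \<open>Passing from the unit sphere to the slice removes the \<open>h\<close>-component of the
  second fundamental form. By \<open>metric_trace_ddx_inner\<close> the removed part has trace m h,
  which is the whole trace.\<close>

lemma minimal_in_small_sphere:
  assumes u: "u \<in> U" and c: "c = x u + h u"
    and S: "\<And>s. s \<in> U \<Longrightarrow> x s \<bullet> c = 1"
  shows "mean_curv_vector (sphere 0 1 \<inter> {q. q \<bullet> c = 1}) x u = 0"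
proof -
  let ?N = "sphere 0 1 \<inter> {q. q \<bullet> c = 1}"
  let ?S = "sphere 0 1 :: 'e set"
  have cc: "c \<bullet> c = 2" using center_inner[OF u] c by simp
  have T: "tangent_space ?N (x u) = {v. v \<bullet> x u = 0 \<and> v \<bullet> c = 0}"
    by (rule tangent_space_small_sphere[OF cc]) (use on_sphere u S in auto)
  \<comment> \<open>As c = x + h, being orthogonal to \<open>x u\<close> and \<open>c\<close>
    amounts to being orthogonal to \<open>x u\<close> and \<open>h u\<close>, which are orthonormal
    by \<open>F_eq_1\<close>.\<close>
  have proj: "orth_proj (tangent_space ?N (x u)) w = w - (w \<bullet> x u) *\<^sub>R x u - (w \<bullet> h u) *\<^sub>R h u" for w
    unfolding T
  proof (rule orth_proj_eqI)
    show "subspace {v. v \<bullet> x u = 0 \<and> v \<bullet> c = 0}" by (auto simp: subspace_def inner_add_left)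
    show "w - (w \<bullet> x u) *\<^sub>R x u - (w \<bullet> h u) *\<^sub>R h u \<in> {v. v \<bullet> x u = 0 \<and> v \<bullet> c = 0}"
      using x_inner_x[OF u] h_inner_x[OF u] F_eq_1[OF u]
      by (simp add: c inner_diff_left inner_add_right inner_commute[of "x u" "h u"])
    show "(w - (w - (w \<bullet> x u) *\<^sub>R x u - (w \<bullet> h u) *\<^sub>R h u)) \<bullet> t = 0" if "t \<in> {v. v \<bullet> x u = 0 \<and> v \<bullet> c = 0}" for t
      using that by (simp add: c inner_add_left inner_add_right inner_commute[of t])
  qed
  have "second_ff ?N x u \<xi> \<zeta> = second_ff ?S x u \<xi> \<zeta> - (ddx u \<xi> \<zeta> \<bullet> h u) *\<^sub>R h u" for \<xi> \<zeta>
    using tan_part_zero[OF u h_inner_push[OF u]]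
    unfolding second_ff_def Let_def pullback_conn_sphere[OF u] pullback_conn_def[of ?N] proj
    by (simp add: linear_diff[OF linear_tan_part[OF u]] linear_scale[OF linear_tan_part[OF u]])
  then have "second_ff ?N x u = (\<lambda>\<xi> \<zeta>. second_ff ?S x u \<xi> \<zeta> - (ddx u \<xi> \<zeta> \<bullet> h u) *\<^sub>R h u)"
    by blast
  then have "metric_trace x u (second_ff ?N x u)
      = metric_trace x u (second_ff ?S x u) - metric_trace x u (\<lambda>\<xi> \<zeta>. (ddx u \<xi> \<zeta> \<bullet> h u) *\<^sub>R h u)"
    by (simp add: metric_trace_diff)
  also have "metric_trace x u (\<lambda>\<xi> \<zeta>. (ddx u \<xi> \<zeta> \<bullet> h u) *\<^sub>R h u) = (metric_trace x u (ddx u) \<bullet> h u) *\<^sub>R h u"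
    by (simp add: metric_trace_def inner_sum_left scaleR_sum_left)
  also have "metric_trace x u (ddx u) \<bullet> h u = real CARD('m)"
    using metric_trace_ddx_inner[OF u, of "h u"] h_inner_push[OF u] F_eq_1[OF u] h_inner_x[OF u]
    by (simp add: inner_commute)
  finally show ?thesis
    by (simp add: mean_curv_vector_def[of ?N] metric_trace_second_ff)
qed

end

section \<open>Globalization\<close>

lemma reflection_exists:
  fixes a b :: "'e::euclidean_space"
  assumes "norm a = norm b"
  obtains T where "orthogonal_transformation T" "T a = b"
proof (cases "a = b")
  case True
  then show ?thesis using that[of id] by (simp add: orthogonal_transformation_def linear_id)
next
  case False
  define d where "d = a - b"
  \<comment> \<open>Householder reflection in the hyperplane orthogonal to \<open>d\<close>; equal
    norms of \<open>a\<close> and \<open>b\<close> give k (a \<bullet> d) = 1, so \<open>a\<close>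
    moves to a - d = b.\<close>
  define k where "k = 2 / (d \<bullet> d)"
  define T where "T v = v - (k * (v \<bullet> d)) *\<^sub>R d" for v
  have d: "d \<bullet> d \<noteq> 0" using False by (simp add: d_def)
  then have k: "k * (d \<bullet> d) = 2" by (simp add: k_def)
  have "linear T"
    by (rule linearI) (simp_all add: T_def inner_add_left algebra_simps)
  moreover have "T v \<bullet> T w = v \<bullet> w" for v w
  proof -
    have "T v \<bullet> T w = v \<bullet> w - 2 * k * (v \<bullet> d) * (w \<bullet> d) + k * (k * (d \<bullet> d)) * (v \<bullet> d) * (w \<bullet> d)"
      by (simp add: T_def inner_diff_left inner_diff_right inner_commute[of d w] algebra_simps)
    then show ?thesis unfolding k by simp
  qed
  moreover have "T a = b"
  proof -
    have "a \<bullet> a = b \<bullet> b" using assms by (simp add: norm_eq)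
    then have "d \<bullet> d = 2 * (a \<bullet> d)"
      by (simp add: d_def inner_diff_left inner_diff_right inner_commute)
    then have "k * (a \<bullet> d) = 1" using k by simp
    then have "T a = a - d" by (simp add: T_def)
    then show ?thesis by (simp add: d_def)
  qed
  ultimately show ?thesis by (intro that[of T]) (auto simp: orthogonal_transformation_def)
qed

text \<open>Puts the model in the form of \<open>tangent_space_small_sphere\<close>, with
  \<open>(0, sqrt 2)\<close>, of squared length 2, in the role of \<open>c\<close>.\<close>

lemma small_hypersphere_eq:
  "small_hypersphere = sphere 0 1 \<inter> {q :: (real^'n) \<times> real. q \<bullet> (0, sqrt 2) = 1}"
proof -
  have "(y, t) \<in> small_hypersphere \<longleftrightarrow> (y, t) \<in> sphere 0 1 \<inter> {q. q \<bullet> (0, sqrt 2) = 1}"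
    for y :: "real^'n" and t :: real
  proof -
    have t: "t * sqrt 2 = 1 \<longleftrightarrow> t = 1 / sqrt 2" by (simp add: field_simps)
    have "norm (y, 1 / sqrt 2) = 1 \<longleftrightarrow> (norm y)\<^sup>2 = 1 / 2"
      by (simp add: norm_Pair power_divide) arith
    then show ?thesis unfolding small_hypersphere_def using t by auto
  qed
  then show ?thesis by auto
qed

lemma orthogonal_image_small_hypersphere:
  fixes T :: "(real^'n) \<times> real \<Rightarrow> (real^'n) \<times> real"
  assumes T: "orthogonal_transformation T"
  shows "T ` small_hypersphere = sphere 0 1 \<inter> {q. q \<bullet> T (0, sqrt 2) = 1}"
proof -
  have inner: "T v \<bullet> T w = v \<bullet> w" for v w
    using T unfolding orthogonal_transformation_def by blast
  have "T v \<in> sphere 0 1 \<inter> {q. q \<bullet> T (0, sqrt 2) = 1} \<longleftrightarrow> v \<in> small_hypersphere" for v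
    using T by (simp add: small_hypersphere_eq inner orthogonal_transformation_norm)
  then have eq: "small_hypersphere = T -` (sphere 0 1 \<inter> {q. q \<bullet> T (0, sqrt 2) = 1})"
    by blast
  show ?thesis
    unfolding eq by (rule surj_image_vimage_eq[OF orthogonal_transformation_surj[OF T]])
qed

section \<open>Independence of the chart and connectedness\<close>

lemma topspace_manifold_topology:
  assumes "submanifold N M A"
  shows "topspace (manifold_topology M A) = M"
proof
  show "topspace (manifold_topology M A) \<subseteq> M"
    using openin_topspace[of "manifold_topology M A"] unfolding openin_manifold_topology by blast
  have "{u \<in> U. x u \<in> M} = U" "open U" if "(U, x) \<in> A" for U x
    using assms that unfolding submanifold_def by blast+
  then have "openin (manifold_topology M A) M"
    unfolding openin_manifold_topology by auto
  then show "M \<subseteq> topspace (manifold_topology M A)" by (rule openin_subset)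
qed

lemma pnmc_chartI:
  fixes A :: "('m::finite, (real^'n) \<times> real) atlas"
  assumes "submanifold unit_sphere M A" "biharmonic unit_sphere A" "pnmc unit_sphere A"
    "pseudo_umbilical unit_sphere A" and chart: "(U, x) \<in> A"
  shows "pnmc_chart U x"
proof
  have U: "open U \<and> smooth_on U x \<and> inj_on x U \<and> (\<forall>u\<in>U. inj (push x u))"
    and sub: "M \<subseteq> unit_sphere" "M = (\<Union>(U, x)\<in>A. x ` U)"
    using assms(1) chart unfolding submanifold_def by blast+
  show "open U" "smooth_on U x" using U by auto
  fix u assume u: "u \<in> U"
  show "inj (push x u)" using U u by blast
  have "x u \<in> unit_sphere" using sub chart u by blast
  then show "x u \<in> sphere 0 1" by (simp add: unit_sphere_def)
  show "mean_curvature (sphere 0 1) x u > 0"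
    "normal_conn (sphere 0 1) x (\<lambda>s. (1 / mean_curvature (sphere 0 1) x s) *\<^sub>R mean_curv_vector (sphere 0 1) x s) u \<xi> = 0"
    for \<xi>
    using assms(3) chart u unfolding pnmc_def unit_sphere_def by blast+
  show "weingarten (sphere 0 1) x (mean_curv_vector (sphere 0 1) x) u \<xi>
      = (mean_curvature (sphere 0 1) x u)\<^sup>2 *\<^sub>R push x u \<xi>" for \<xi>
    using assms(4) chart u unfolding pseudo_umbilical_def unit_sphere_def by blast
  show "rough_laplacian (sphere 0 1) x (mean_curv_vector (sphere 0 1) x) u
    + metric_trace x u (\<lambda>\<xi> \<eta>. curvature (sphere 0 1) (x u) (push x u \<xi>)
        (mean_curv_vector (sphere 0 1) x u) (push x u \<eta>)) = 0"
    using assms(2) chart u unfolding biharmonic_def unit_sphere_def by blast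
qed

text \<open>The continuous transition map sends a neighbourhood of \<open>u\<close> into one of
  \<open>v\<close> where y + h is constant, so \<open>x\<close> satisfies the hypotheses of
  \<open>center_unique\<close> with that constant.\<close>

lemma center_chart_independent:
  fixes A :: "('m::finite, 'e::euclidean_space) atlas"
  assumes sub: "submanifold N M A" and charts: "(U, x) \<in> A" "(V, y) \<in> A"
    and "pnmc_chart U x" "pnmc_chart V y"
    and u: "u \<in> U" "v \<in> V" "x u = y v"
  shows "y v + mean_curv_vector (sphere 0 1) y v = x u + mean_curv_vector (sphere 0 1) x u"
proof -
  interpret X: pnmc_chart U x by fact
  interpret Y: pnmc_chart V y by fact
  let ?c = "y v + Y.h v"
  let ?\<phi> = "\<lambda>u. inv_into V y (x u)"
  obtain V' where V': "open V'" "v \<in> V'" "V' \<subseteq> V" "\<And>s. s \<in> V' \<Longrightarrow> y s + Y.h s = ?c"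
    using Y.center_locally_constant[OF u(2)] by blast
  define W where "W = {u \<in> U. x u \<in> y ` V}"
  have "open W" "smooth_on W ?\<phi>" "inj_on y V"
    using sub charts unfolding submanifold_def Let_def W_def by blast+
  then have "continuous_on W ?\<phi>" unfolding smooth_on_def using Ck_on.simps(1) by blast
  with \<open>open W\<close> have "open (W \<inter> ?\<phi> -` V')"
    using continuous_open_preimage V'(1) by blast
  moreover have "?\<phi> u = v" using u \<open>inj_on y V\<close> by simp
  then have "u \<in> W \<inter> ?\<phi> -` V'" using u V'(2) by (auto simp: W_def)
  moreover have "W \<inter> ?\<phi> -` V' \<subseteq> U" by (auto simp: W_def)
  moreover have "?c \<bullet> ?c = 2" by (rule Y.center_inner(1)[OF u(2)])
  moreover have "x s \<bullet> ?c = 1" if "s \<in> W \<inter> ?\<phi> -` V'" for s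
  proof -
    have s: "y (?\<phi> s) = x s" "?\<phi> s \<in> V'" using that by (auto simp: W_def f_inv_into_f)
    have "y (?\<phi> s) \<bullet> (y (?\<phi> s) + Y.h (?\<phi> s)) = 1"
      by (rule Y.center_inner(2)) (use s(2) V'(3) in blast)
    then show ?thesis unfolding V'(4)[OF s(2)] unfolding s(1) .
  qed
  ultimately show ?thesis by (rule X.center_unique)
qed

text \<open>The points whose vector x + h equals a given \<open>c\<close> form a clopen set in the
  manifold topology.\<close>

lemma center_constant:
  fixes A :: "('m::finite, 'e::euclidean_space) atlas"
  assumes sub: "submanifold N M A" and charts: "\<And>U x. (U, x) \<in> A \<Longrightarrow> pnmc_chart U x"
    and base: "(U0, x0) \<in> A" "u0 \<in> U0" and chart: "(U, x) \<in> A" "u \<in> U"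
  shows "x u + mean_curv_vector (sphere 0 1) x u = x0 u0 + mean_curv_vector (sphere 0 1) x0 u0"
proof -
  let ?h = "mean_curv_vector (sphere 0 1)"
  let ?top = "manifold_topology M A"
  define c where "c = x0 u0 + ?h x0 u0"
  define Z where "Z = {p. \<exists>(U, x)\<in>A. \<exists>u\<in>U. x u = p \<and> x u + ?h x u = c}"
  have M: "M = (\<Union>(U, x)\<in>A. x ` U)" using sub unfolding submanifold_def by blast
  \<comment> \<open>\<open>Z\<close> asks for some chart; chart independence turns this into a
    condition in any given chart.\<close>
  have Z_iff: "y v \<in> Z \<longleftrightarrow> y v + ?h y v = c" if V: "(V, y) \<in> A" "v \<in> V" for V y v
  proof
    assume "y v \<in> Z"
    then obtain U x u where U: "(U, x) \<in> A" "u \<in> U" "x u = y v" "x u + ?h x u = c"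
      unfolding Z_def by blast
    show "y v + ?h y v = c"
      using center_chart_independent[OF sub U(1) V(1) charts[OF U(1)] charts[OF V(1)] U(2) V(2) U(3)] U(4)
      by (rule trans)
  qed (use V in \<open>auto simp: Z_def\<close>)
  have "Z \<subseteq> M" unfolding Z_def M by blast
  \<comment> \<open>A general \<open>P\<close> serves both \<open>Z\<close> and its complement,
    since a locally constant map has open preimages of all sets.\<close>
  have open_center: "open {v \<in> V. P (y v + ?h y v)}" if "(V, y) \<in> A" for V y P
  proof -
    interpret pnmc_chart V y by (rule charts[OF that])
    show ?thesis
    proof (subst open_subopen, intro ballI)
      fix v assume v: "v \<in> {v \<in> V. P (y v + ?h y v)}"
      then obtain W where W: "open W" "v \<in> W" "W \<subseteq> V" "\<And>s. s \<in> W \<Longrightarrow> y s + ?h y s = y v + ?h y v"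
        using center_locally_constant by blast
      have "W \<subseteq> {v \<in> V. P (y v + ?h y v)}"
      proof
        fix s assume "s \<in> W"
        then show "s \<in> {v \<in> V. P (y v + ?h y v)}" using W(3) W(4)[of s] v by auto
      qed
      then show "\<exists>T. open T \<and> v \<in> T \<and> T \<subseteq> {v \<in> V. P (y v + ?h y v)}" using W by blast
    qed
  qed
  have "openin ?top Z"
    unfolding openin_manifold_topology
  proof (intro conjI \<open>Z \<subseteq> M\<close>, clarify)
    fix V y assume V: "(V, y) \<in> A"
    have "{v \<in> V. y v \<in> Z} = {v \<in> V. y v + ?h y v = c}" using Z_iff[OF V] by blast
    then show "open {v \<in> V. y v \<in> Z}" using open_center[OF V, of "\<lambda>w. w = c"] by simp
  qed
  moreover have "openin ?top (M - Z)"
    unfolding openin_manifold_topology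
  proof (intro conjI Diff_subset, clarify)
    fix V y assume V: "(V, y) \<in> A"
    have "y v \<in> M" if "v \<in> V" for v using V that M by blast
    then have "{v \<in> V. y v \<in> M - Z} = {v \<in> V. y v + ?h y v \<noteq> c}" using Z_iff[OF V] by blast
    then show "open {v \<in> V. y v \<in> M - Z}" using open_center[OF V, of "\<lambda>w. w \<noteq> c"] by simp
  qed
  then have "closedin ?top Z"
    by (simp add: closedin_def topspace_manifold_topology[OF sub] \<open>Z \<subseteq> M\<close>)
  moreover have "connected_space ?top" using sub unfolding submanifold_def by blast
  ultimately have "Z = {} \<or> Z = M"
    unfolding connected_space_clopen_in topspace_manifold_topology[OF sub] by blast
  moreover have "x0 u0 \<in> Z" using Z_iff[OF base] by (simp add: c_def)
  ultimately have "x u \<in> Z" using M chart by blast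
  then show ?thesis using Z_iff[OF chart] by (simp add: c_def)
qed

theorem proposition4p2:
  fixes M :: "((real^'n) \<times> real) set"
    and A :: "('m::finite, (real^'n) \<times> real) atlas"
  assumes "submanifold unit_sphere M A"
    and "biharmonic unit_sphere A"
    and "pnmc unit_sphere A"
    and "pseudo_umbilical unit_sphere A"
  shows "\<exists>T :: (real^'n) \<times> real \<Rightarrow> (real^'n) \<times> real. orthogonal_transformation T \<and>
           submanifold (T ` small_hypersphere) M A \<and>
           minimal (T ` small_hypersphere) A"
proof -
  let ?h = "mean_curv_vector (sphere 0 1)"
  note charts = pnmc_chartI[OF assms]
  have "\<exists>c. c \<bullet> c = 2 \<and> (\<forall>(U, x)\<in>A. \<forall>u\<in>U. x u + ?h x u = c)"
  proof (cases "\<exists>(U, x)\<in>A. U \<noteq> {}")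
    case True
    then obtain U0 x0 u0 where base: "(U0, x0) \<in> A" "u0 \<in> U0" by blast
    then show ?thesis
      using center_constant[OF assms(1) charts base] pnmc_chart.center_inner(1)[OF charts[OF base(1)] base(2)]
      by blast
  next
    case False
    \<comment> \<open>Here \<open>M\<close> has no points, so any vector of squared length 2 serves
      as \<open>c\<close>.\<close>
    have "(0::real^'n, sqrt 2) \<bullet> (0, sqrt 2) = 2" by simp
    with False show ?thesis by blast
  qed
  then obtain c where c: "c \<bullet> c = 2" "\<And>U x u. (U, x) \<in> A \<Longrightarrow> u \<in> U \<Longrightarrow> x u + ?h x u = c"
    by blast
  \<comment> \<open>Equal lengths allow an orthogonal map to carry the vector of the model
    hypersphere to \<open>c\<close>.\<close>
  have "norm (0::real^'n, sqrt 2) = norm c"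
    by (simp add: norm_eq_sqrt_inner[of c] c(1))
  then obtain T where T: "orthogonal_transformation T" "T (0::real^'n, sqrt 2) = c"
    by (rule reflection_exists)
  have image: "T ` small_hypersphere = sphere 0 1 \<inter> {q. q \<bullet> c = 1}"
    using orthogonal_image_small_hypersphere[OF T(1)] T(2) by simp
  have inner: "x u \<bullet> c = 1" if "(U, x) \<in> A" "u \<in> U" for U x u
    using pnmc_chart.center_inner(2)[OF charts[OF that(1)] that(2)] c(2)[OF that] by simp
  have "M \<subseteq> unit_sphere" "M = (\<Union>(U, x)\<in>A. x ` U)"
    using assms(1) unfolding submanifold_def by blast+
  then have "M \<subseteq> T ` small_hypersphere"
    using inner unfolding image unit_sphere_def by auto
  \<comment> \<open>The ambient set enters \<open>submanifold\<close> only through the inclusion of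
    \<open>M\<close>.\<close>
  then have "submanifold (T ` small_hypersphere) M A"
    using assms(1) unfolding submanifold_def by blast
  moreover have "minimal (T ` small_hypersphere) A"
    unfolding minimal_def image
    using pnmc_chart.minimal_in_small_sphere[OF charts] inner c(2) by blast
  ultimately show ?thesis using T(1) by blast
qed

end
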